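(* Let $1\le k\le n$ be integers. There exist $\delta(n)>0$ and $D(n)$ such that the following holds. Let $\{B_{r_j}(x_j)\}_{x_j\in S}$ be a collection of disjoint balls contained in $B_2(0^n)\subseteq\mathbb{R}^n$, and let $\mu=\sum_{x_j\in S}\omega_kr_j^k\delta_{x_j}$ be the associated measure. Assume that for each ball $B_r(x)\subseteq B_2(0^n)$ with $\mu(B_r(x))\ge\epsilon_nr^k$ $$\int_{B_r(x)}\Big(\int_0^rD^k_\mu(y,s)\,\frac{ds}{s}\Big)\,d\mu(y)<\delta^2r^k.$$ Then $$\sum_{x_j\in B_1(0^n)}r_j^k<D(n).$$
   Context: $\omega_k$ is the volume of the unit ball in $\mathbb{R}^k$, $\delta_{x}$ the Dirac mass at $x$, and $\epsilon_n=(1000n)^{-7n^2}$. For a measure $\mu$ on $B_2(0^n)$, define $$D^k_\mu(x,r)=\inf_{L^k}r^{-(k+2)}\int_{B_r(x)}d^2(y,L^k)\,d\mu(y)\quad\text{if }\mu(B_r(x))\ge\epsilon_nr^k,$$ and $D^k_\mu(x,r)=0$ otherwise, the infimum being over all $k$-dimensional affine subspaces of $\mathbb{R}^n$. *)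

theory Defs
  imports "HOL-Analysis.Analysis"
begin

definition eps :: "nat \<Rightarrow> real" where
  "eps n = (1000 * real n) powi (- int (7 * n\<^sup>2))"

text \<open>
  The displacement is defined for a Borel measure on all of \<open>\<real>\<^sup>n\<close>; a measure on the ball of
  radius 2 about the origin is regarded as a measure on \<open>\<real>\<^sup>n\<close> that vanishes outside that ball.
  Values lie in \<open>[0,\<infinity>]\<close>, so that no integrability is silently assumed or lost when the measure
  is not locally finite.
\<close>

definition displacement ::
  "nat \<Rightarrow> (real ^ 'n) measure \<Rightarrow> real ^ 'n \<Rightarrow> real \<Rightarrow> ennreal" where
  "displacement k \<mu> x r =
     (if emeasure \<mu> (ball x r) \<ge> ennreal (eps CARD('n) * r ^ k)
      then INF L\<in>{L. affine L \<and> aff_dim L = int k}.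
             ennreal (r powi (- int (k + 2))) *
             (\<integral>\<^sup>+y\<in>ball x r. ennreal ((infdist y L)\<^sup>2) \<partial>\<mu>)
      else 0)"

text \<open>
  The measure \<open>\<Sum>x\<in>S. \<omega>\<^sub>k r\<^sub>x\<^sup>k \<delta>\<^sub>x\<close> on the Borel sets of \<open>\<real>\<^sup>n\<close>, as the push-forward along the
  inclusion of the weighted counting measure on the possibly infinite set \<open>S\<close>. Here \<open>\<omega>\<^sub>k\<close> is
  \<^const>\<open>unit_ball_vol\<close> at \<open>k\<close>.
\<close>

definition ball_measure ::
  "nat \<Rightarrow> (real ^ 'n) set \<Rightarrow> (real ^ 'n \<Rightarrow> real) \<Rightarrow> (real ^ 'n) measure" where
  "ball_measure k S r =
     distr (point_measure S (\<lambda>x. ennreal (unit_ball_vol (real k) * r x ^ k))) borel (\<lambda>x. x)"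

lemma sets_ball_measure [simp]: "sets (ball_measure k S r) = sets borel"
  by (simp add: ball_measure_def)

lemma emeasure_ball_measure:
  assumes "A \<in> sets borel"
  shows "emeasure (ball_measure k S r) A =
    (\<integral>\<^sup>+x. ennreal (unit_ball_vol (real k) * r x ^ k) * indicator A x \<partial>count_space S)"
proof -
  have m: "(\<lambda>x. x) \<in> point_measure S (\<lambda>x. ennreal (unit_ball_vol (real k) * r x ^ k))
      \<rightarrow>\<^sub>M borel"
    by (simp add: point_measure_def)
  show ?thesis
    unfolding ball_measure_def
    using assms m
    by (auto simp: emeasure_distr point_measure_def emeasure_density space_density
        intro!: nn_integral_cong split: split_indicator)
qed

end

(*
  Fix k and a finite set of centres with masses r^k. Let phi_j, j = 0, 1, ..., be radial kernels on R^n of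
  width 4^-j whose restrictions to k-planes satisfy an exact refinement equation: phi_j is the convolution
  of phi_(j+1) with a radial probability density. For a point x and any k-plane L, transporting x to a random
  point Y of L near the projection of x gives, since the kernels are radially decreasing and Lipschitz in the
  squared distance,
    phi_j(x - z) <= E phi_(j+1)(Y - z) + C 4^(j(k+2)) d(z,L)^2.
  Summing over z, the smoothed density at scale 4^-j at x is at most an average of the smoothed densities at
  scale 4^-(j+1) plus the displacement at scale 4^-j. Going from fine to coarse scales, the errors that
  accumulate along a path ending near a centre g are at most the sum of the displacements at g, because
  the displacement at a point is controlled by the one of g at a comparable scale; so no comparison of planes
  at different scales is needed. The centres at which the displacements sum to more than 1 have bounded total
  mass by the integral hypothesis on the ball of radius 2, and are dropped. A centre z enters the density
  only at scales at least r_z / 64; at the scale where it enters, by disjointness, no other centre is near it.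
*)

theory Submission
  imports Defs
begin

section \<open>Lebesgue measure on coordinate planes\<close>

text \<open>The number of scales grows without bound as the smallest radius tends to 0, so no step
  may lose a fixed amount or a fixed factor. This is why the refinement equation has to be exact,
  and why the kernels are finite convolutions of one bump at all scales down to a last one. It is
  also why the dependence on the distance to the plane has to be quadratic: the loss at one scale is
  then linear in the displacement, the quantity whose sum over the scales is under control; a loss
  linear in the distance would bring in square roots. The bump 1 - |y|^2 has this dependence, and
  convolution with symmetric densities keeps it. The displacement is 0 by definition where there is
  little mass, so it yields no plane there; but at such places the smoothed density is bounded
  outright. Since the losses are merely added up and a total of order 1 is affordable, delta = 1 is
  a possible choice. Only one coordinate k-plane carries a measure; all other k-planes are reached
  from it by isometries.\<close>

lemma nn_integral_lborel_shift:
  fixes f :: "'a::euclidean_space \<Rightarrow> ennreal"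
  assumes [measurable]: "f \<in> borel_measurable borel"
  shows "(\<integral>\<^sup>+x. f (c + x) \<partial>lborel) = (\<integral>\<^sup>+x. f x \<partial>lborel)"
proof -
  have "(\<integral>\<^sup>+x. f x \<partial>lborel) = (\<integral>\<^sup>+x. f x \<partial>distr lborel borel ((+) c))"
    by (simp add: lborel_distr_plus)
  also have "\<dots> = (\<integral>\<^sup>+x. f (c + x) \<partial>lborel)"
    by (rule nn_integral_distr) simp_all
  finally show ?thesis by simp
qed

text \<open>Both sides are invariant under translations, so a Fubini argument shows that they are
  proportional; the unit ball gives the factor 1.\<close>

lemma lborel_distr_orthogonal_transformation:
  fixes T :: "'a::euclidean_space \<Rightarrow> 'a"
  assumes T: "orthogonal_transformation T"
  shows "distr lborel borel T = lborel"
proof (rule measure_eqI)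
  fix A assume "A \<in> sets (distr lborel borel T)"
  then have [measurable]: "A \<in> sets borel" by simp
  have lin: "linear T" using T by (rule orthogonal_transformation_linear)
  have [measurable]: "T \<in> borel_measurable borel"
    using lin by (simp add: borel_measurable_continuous_onI linear_continuous_on linear_linear)
  let ?B = "ball (0::'a) 1"
  let ?v = "emeasure lborel ?B"
  have iA: "(\<lambda>x. indicator C (g x) :: ennreal) \<in> borel_measurable (lborel \<Otimes>\<^sub>M lborel)"
    if "g \<in> borel_measurable (lborel \<Otimes>\<^sub>M lborel)" "C \<in> sets borel" for g :: "'a \<times> 'a \<Rightarrow> 'a" and C
    using measurable_compose[OF that(1) borel_measurable_indicator] that(2) by blast
  have iA1: "(\<lambda>x. indicator C (g x) :: ennreal) \<in> borel_measurable borel"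
    if "g \<in> borel_measurable borel" "C \<in> sets borel" for g :: "'a \<Rightarrow> 'a" and C
    using measurable_compose[OF that(1) borel_measurable_indicator] that(2) by blast
  have [measurable]: "?B \<in> sets borel" by simp
  have vball: "emeasure lborel (ball y 1) = ?v" for y :: 'a
    by (simp add: emeasure_ball)
  \<comment> \<open>The Fubini argument measures the pairs (w, y) with \<open>y\<close> in
    \<open>?B\<close> and \<open>y + T w\<close> in \<open>A\<close>. As \<open>T\<close> is onto,
    \<open>y = T y'\<close>, and adding \<open>y\<close> amounts to a translation of
    \<open>w\<close>. In the other order, replacing \<open>y\<close> by \<open>y - T w\<close>
    leaves the condition that \<open>w\<close> is within 1 of \<open>y'\<close>, because
    \<open>T\<close> is an isometry.\<close>
  have "?v * emeasure (distr lborel borel T) A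
      = (\<integral>\<^sup>+y. indicator ?B y * (\<integral>\<^sup>+w. indicator A (T w) \<partial>lborel) \<partial>lborel)"
  proof -
    have "emeasure (distr lborel borel T) A = (\<integral>\<^sup>+w. indicator A w \<partial>distr lborel borel T)"
      by simp
    also have "\<dots> = (\<integral>\<^sup>+w. indicator A (T w) \<partial>lborel)"
      by (rule nn_integral_distr) auto
    finally show ?thesis
      by (subst nn_integral_multc) (auto intro!: borel_measurable_indicator)
  qed
  also have "\<dots> = (\<integral>\<^sup>+y. (\<integral>\<^sup>+w. indicator ?B y * indicator A (y + T w) \<partial>lborel) \<partial>lborel)"
  proof (rule nn_integral_cong)
    fix y :: 'a
    obtain y' where y': "y = T y'"
      using orthogonal_transformation_surj[OF T] by (metis surjD)
    have "(\<integral>\<^sup>+w. indicator A (T w) \<partial>lborel) = (\<integral>\<^sup>+w. indicator A (T (y' + w)) \<partial>lborel :: ennreal)"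
      by (rule nn_integral_lborel_shift[symmetric]) (auto intro!: iA1)
    also have "\<dots> = (\<integral>\<^sup>+w. indicator A (y + T w) \<partial>lborel)"
      using lin by (simp add: y' linear_add)
    finally show "indicator ?B y * (\<integral>\<^sup>+w. indicator A (T w) \<partial>lborel)
       = (\<integral>\<^sup>+w. indicator ?B y * indicator A (y + T w) \<partial>lborel :: ennreal)"
      by (subst nn_integral_cmult) (auto intro!: iA1)
  qed
  also have "\<dots> = (\<integral>\<^sup>+w. (\<integral>\<^sup>+y. indicator ?B y * indicator A (y + T w) \<partial>lborel) \<partial>lborel)"
    by (rule lborel_pair.Fubini')
       (auto simp: split_beta' intro!: borel_measurable_times_ennreal iA)
  also have "\<dots> = (\<integral>\<^sup>+w. (\<integral>\<^sup>+y. indicator ?B (y - T w) * indicator A y \<partial>lborel) \<partial>lborel)"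
  proof (rule nn_integral_cong)
    fix w :: 'a
    show "(\<integral>\<^sup>+y. indicator ?B y * indicator A (y + T w) \<partial>lborel)
      = (\<integral>\<^sup>+y. indicator ?B (y - T w) * indicator A y \<partial>lborel :: ennreal)"
      by (subst nn_integral_lborel_shift[of "\<lambda>y. indicator ?B (y - T w) * indicator A y" "T w", symmetric])
         (auto simp: add.commute intro!: borel_measurable_times_ennreal iA1)
  qed
  also have "\<dots> = (\<integral>\<^sup>+y. (\<integral>\<^sup>+w. indicator ?B (y - T w) * indicator A y \<partial>lborel) \<partial>lborel)"
    by (rule lborel_pair.Fubini')
       (auto simp: split_beta' intro!: borel_measurable_times_ennreal iA)
  also have "\<dots> = (\<integral>\<^sup>+y. ?v * indicator A y \<partial>lborel)"
  proof (rule nn_integral_cong)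
    fix y :: 'a
    obtain y' where y': "y = T y'"
      using orthogonal_transformation_surj[OF T] by (metis surjD)
    have "norm (y - T w) = norm (y' - w)" for w
      using linear_diff[OF lin, of y' w] orthogonal_transformation_norm[OF T, of "y' - w"]
      by (simp add: y')
    then have "indicator ?B (y - T w) = (indicator (ball y' 1) w :: ennreal)" for w
      by (simp add: indicator_def dist_norm norm_minus_commute)
    then have "(\<integral>\<^sup>+w. indicator ?B (y - T w) * indicator A y \<partial>lborel)
       = (\<integral>\<^sup>+w. indicator (ball y' 1) w * indicator A y \<partial>lborel)"
      by (simp only:)
    also have "\<dots> = ?v * indicator A y"
      by (subst nn_integral_multc) (auto simp: vball[of y'] intro!: borel_measurable_indicator)
    finally show "(\<integral>\<^sup>+w. indicator ?B (y - T w) * indicator A y \<partial>lborel) = ?v * indicator A y" .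
  qed
  also have "\<dots> = ?v * emeasure lborel A"
    by (simp add: nn_integral_cmult_indicator)
  finally have eq: "?v * emeasure (distr lborel borel T) A = ?v * emeasure lborel A" .
  have "unit_ball_vol (real DIM('a)) > 0" by (rule unit_ball_vol_pos) simp
  then have "?v \<noteq> 0" by (simp add: emeasure_ball del: unit_ball_vol_pos)
  moreover have "?v \<noteq> top" by (simp add: emeasure_ball)
  ultimately show "emeasure (distr lborel borel T) A = emeasure lborel A"
    using ennreal_mult_cancel_left[THEN iffD1, OF eq] by blast
qed simp

section \<open>Measures on coordinate planes and their symmetries\<close>

definition coord_proj :: "'a::euclidean_space set \<Rightarrow> 'a \<Rightarrow> 'a" where
  "coord_proj K w = (\<Sum>b\<in>K. (w \<bullet> b) *\<^sub>R b)"

text \<open>The projection of all of \<open>lborel\<close> would give infinite mass to bounded sets.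
  A fixed thickness in the complementary directions makes the image locally finite, at the price of
  a constant factor that the normalisation of the kernels absorbs.\<close>

definition slab :: "'a::euclidean_space set \<Rightarrow> 'a set" where
  "slab K = {w. \<forall>b\<in>Basis - K. \<bar>w \<bullet> b\<bar> \<le> 1}"

text \<open>A multiple of the \<open>card K\<close>-dimensional Lebesgue measure of \<open>span K\<close>, for a set \<open>K\<close> of
  basis vectors.\<close>

definition flat_lborel :: "'a::euclidean_space set \<Rightarrow> 'a measure" where
  "flat_lborel K = distr (density lborel (indicator (slab K))) borel (coord_proj K)"

lemma inner_coord_proj:
  assumes "K \<subseteq> Basis" "b \<in> Basis"
  shows "coord_proj K w \<bullet> b = (if b \<in> K then w \<bullet> b else 0)"
proof -
  have fin: "finite K" using assms finite_subset finite_Basis by blast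
  have "coord_proj K w \<bullet> b = (\<Sum>c\<in>K. (w \<bullet> c) * (c \<bullet> b))"
    by (simp add: coord_proj_def inner_sum_left)
  also have "\<dots> = (\<Sum>c\<in>K. if c = b then w \<bullet> b else 0)"
    using assms by (intro sum.cong) (auto simp: inner_Basis)
  finally show ?thesis using fin by simp
qed

lemma coord_proj_add: "coord_proj K (v + w) = coord_proj K v + coord_proj K w"
  by (simp add: coord_proj_def inner_add_left scaleR_add_left sum.distrib)

lemma coord_proj_scaleR: "coord_proj K (c *\<^sub>R w) = c *\<^sub>R coord_proj K w"
  by (simp add: coord_proj_def scaleR_sum_right)

lemma coord_proj_in_span: "coord_proj K w \<in> span K"
  unfolding coord_proj_def by (intro span_sum span_scale span_base)

lemma measurable_coord_proj [measurable]: "coord_proj K \<in> borel_measurable borel"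
  unfolding coord_proj_def[abs_def] by measurable

lemma slab_measurable [measurable]: "slab K \<in> sets borel"
proof -
  have "closed (slab K)"
    unfolding slab_def Collect_ball_eq
    by (intro closed_INT ballI closed_Collect_le continuous_intros)
  then show ?thesis by simp
qed

lemma sets_flat_lborel [simp, measurable_cong]: "sets (flat_lborel K) = sets borel"
  by (simp add: flat_lborel_def)

lemma space_flat_lborel [simp]: "space (flat_lborel K) = UNIV"
  by (simp add: flat_lborel_def)

lemma span_Basis_orthogonal:
  assumes "K \<subseteq> Basis" "u \<in> span K" "b \<in> Basis - K"
  shows "u \<bullet> b = 0"
  using assms(2)
  by (induction rule: span_induct_alt)
     (use assms(1,3) in \<open>auto simp: inner_add_left subset_eq dest: inner_not_same_Basis\<close>)

lemma coord_proj_id: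
  assumes "K \<subseteq> Basis" "u \<in> span K"
  shows "coord_proj K u = u"
  by (rule euclidean_eqI) (use span_Basis_orthogonal[OF assms] in \<open>auto simp: inner_coord_proj[OF assms(1)]\<close>)

lemma nn_integral_flat_lborel:
  assumes [measurable]: "f \<in> borel_measurable borel"
  shows "(\<integral>\<^sup>+y. f y \<partial>flat_lborel K) = (\<integral>\<^sup>+w. indicator (slab K) w * f (coord_proj K w) \<partial>lborel)"
  unfolding flat_lborel_def
  by (subst nn_integral_distr) (auto simp: nn_integral_density)

text \<open>Symmetries of the plane are obtained from symmetries \<open>T\<close> of the whole space
  that preserve the slab and lie over \<open>S\<close> under the projection.\<close>

lemma flat_lborel_distr:
  assumes T: "distr lborel borel T = lborel" "T \<in> borel_measurable borel"
    and S: "S \<in> borel_measurable borel"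
    and slab: "\<And>w. T w \<in> slab K \<longleftrightarrow> w \<in> slab K"
    and comm: "\<And>w. coord_proj K (T w) = S (coord_proj K w)"
  shows "distr (flat_lborel K) borel S = flat_lborel K"
proof (rule measure_eqI)
  note [measurable] = T(2) S
  fix A assume "A \<in> sets (distr (flat_lborel K) borel S)"
  then have A [measurable]: "A \<in> sets borel" by simp
  have ind: "(\<lambda>x. indicator A (h x) :: ennreal) \<in> borel_measurable borel"
    if "h \<in> borel_measurable borel" for h :: "'a \<Rightarrow> 'a"
    using measurable_compose[OF that borel_measurable_indicator] A by blast
  have "emeasure (distr (flat_lborel K) borel S) A = (\<integral>\<^sup>+y. indicator A y \<partial>distr (flat_lborel K) borel S)"
    by simp
  also have "\<dots> = (\<integral>\<^sup>+y. indicator A (S y) \<partial>flat_lborel K)"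
    by (rule nn_integral_distr) (auto intro: borel_measurable_indicator)
  also have "\<dots> = (\<integral>\<^sup>+w. indicator (slab K) w * indicator A (S (coord_proj K w)) \<partial>lborel)"
    by (rule nn_integral_flat_lborel) (rule ind[OF S])
  also have "\<dots> = (\<integral>\<^sup>+w. indicator (slab K) (T w) * indicator A (coord_proj K (T w)) \<partial>lborel)"
    by (simp add: slab comm indicator_def)
  also have "\<dots> = (\<integral>\<^sup>+w. indicator (slab K) w * indicator A (coord_proj K w) \<partial>distr lborel borel T)"
    by (rule nn_integral_distr[symmetric])
       (auto intro!: borel_measurable_times_ennreal borel_measurable_indicator ind)
  also have "\<dots> = (\<integral>\<^sup>+y. indicator A y \<partial>flat_lborel K)"
    unfolding T(1) by (rule nn_integral_flat_lborel[symmetric]) (rule borel_measurable_indicator[OF A])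
  finally show "emeasure (distr (flat_lborel K) borel S) A = emeasure (flat_lborel K) A"
    by simp
qed simp

lemma flat_lborel_shift:
  assumes "K \<subseteq> Basis" "u \<in> span K"
  shows "distr (flat_lborel K) borel ((+) u) = flat_lborel K"
proof (rule flat_lborel_distr[where T="(+) u"])
  show "u + w \<in> slab K \<longleftrightarrow> w \<in> slab K" for w
    using span_Basis_orthogonal[OF assms] by (simp add: slab_def inner_add_left)
  show "coord_proj K (u + w) = u + coord_proj K w" for w
    by (simp add: coord_proj_add coord_proj_id[OF assms])
qed (auto simp: lborel_distr_plus)

lemma flat_lborel_orthogonal_transformation:
  assumes "orthogonal_transformation T"
    and "\<And>w. T w \<in> slab K \<longleftrightarrow> w \<in> slab K"
    and "\<And>w. coord_proj K (T w) = T (coord_proj K w)"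
  shows "distr (flat_lborel K) borel T = flat_lborel K"
proof (rule flat_lborel_distr)
  show "distr lborel borel T = lborel"
    by (rule lborel_distr_orthogonal_transformation[OF assms(1)])
  show "T \<in> borel_measurable borel"
    using orthogonal_transformation_linear[OF assms(1)]
    by (simp add: borel_measurable_continuous_onI linear_continuous_on linear_linear)
  then show "T \<in> borel_measurable borel" .
qed (use assms in auto)

lemma flat_lborel_uminus: "distr (flat_lborel K) borel uminus = flat_lborel K"
  by (rule flat_lborel_orthogonal_transformation)
     (auto simp: orthogonal_transformation_def slab_def linear_iff coord_proj_def scaleR_sum_right
       sum_negf)

lemma flat_lborel_reflection:
  assumes K: "K \<subseteq> Basis" and v: "v \<in> span K" "norm v = 1"
  shows "distr (flat_lborel K) borel (\<lambda>y. y - (2 * (y \<bullet> v)) *\<^sub>R v) = flat_lborel K"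
proof (rule flat_lborel_orthogonal_transformation)
  have vv: "v \<bullet> v = 1" using v(2) by (simp add: dot_square_norm)
  show "orthogonal_transformation (\<lambda>y. y - (2 * (y \<bullet> v)) *\<^sub>R v)"
    unfolding orthogonal_transformation_def
    by (auto simp: linear_iff algebra_simps inner_simps vv inner_commute)
  show "w - (2 * (w \<bullet> v)) *\<^sub>R v \<in> slab K \<longleftrightarrow> w \<in> slab K" for w
    using span_Basis_orthogonal[OF K v(1)] by (simp add: slab_def inner_diff_left)
  have "coord_proj K w \<bullet> v = w \<bullet> v" for w
  proof -
    have "coord_proj K w \<bullet> v = w \<bullet> coord_proj K v"
      by (simp add: coord_proj_def inner_sum_left inner_sum_right inner_commute mult.commute)
    then show ?thesis by (simp add: coord_proj_id[OF K v(1)])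
  qed
  then show "coord_proj K (w - (2 * (w \<bullet> v)) *\<^sub>R v)
      = coord_proj K w - (2 * (coord_proj K w \<bullet> v)) *\<^sub>R v" for w
    using coord_proj_add[of K w "(- (2 * (w \<bullet> v))) *\<^sub>R v"]
    by (simp add: coord_proj_scaleR coord_proj_id[OF K v(1)] del: scaleR_minus_left)
       (simp add: coord_proj_add coord_proj_scaleR coord_proj_id[OF K v(1)])
qed

lemma nn_integral_flat_lborel_scale:
  assumes K: "K \<subseteq> Basis" and c: "c > 0" and f [measurable]: "f \<in> borel_measurable borel"
  shows "(\<integral>\<^sup>+y. f y \<partial>flat_lborel K) = ennreal (c ^ card K) * (\<integral>\<^sup>+y. f (c *\<^sub>R y) \<partial>flat_lborel K)"
proof -
  \<comment> \<open>Only the directions of \<open>K\<close> are stretched: the slab stays in place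
    and the Jacobian is \<open>c ^ card K\<close>, not a power with exponent the full
    dimension.\<close>
  define d where "d b = (if b \<in> K then c else 1)" for b :: 'a
  define T where "T x = 0 + (\<Sum>j\<in>Basis. (d j * (x \<bullet> j)) *\<^sub>R j)" for x :: 'a
  have Tb: "T x \<bullet> b = d b * (x \<bullet> b)" if "b \<in> Basis" for x b
    using that by (simp add: T_def inner_sum_left inner_Basis if_distrib cong: if_cong)
  have fT: "(\<lambda>w. f (c *\<^sub>R w)) \<in> borel_measurable borel" by measurable
  have T [measurable]: "T \<in> borel_measurable borel" by (simp add: T_def[abs_def])
  have slabT: "indicator (slab K) (T w) = (indicator (slab K) w :: ennreal)" for w
    by (auto simp: indicator_def slab_def Tb d_def)
  have projT: "coord_proj K (T w) = c *\<^sub>R coord_proj K w" for w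
    by (rule euclidean_eqI) (auto simp: inner_coord_proj[OF K] Tb d_def)
  have m: "(\<lambda>w. indicator (slab K) w * f (coord_proj K w)) \<in> borel_measurable borel"
    by (intro borel_measurable_times_ennreal borel_measurable_indicator) measurable
  have prod: "(\<Prod>j\<in>Basis. \<bar>d j\<bar>) = c ^ card K"
    using K c by (simp add: d_def prod.If_cases Int_absorb1)
  have "(\<integral>\<^sup>+y. f y \<partial>flat_lborel K)
     = (\<integral>\<^sup>+w. indicator (slab K) w * f (coord_proj K w) \<partial>density (distr lborel borel T) (\<lambda>_. (\<Prod>j\<in>Basis. \<bar>d j\<bar>)))"
    using lborel_affine_euclidean[of d 0, folded T_def] c
    by (simp add: nn_integral_flat_lborel d_def[abs_def])
  also have "\<dots> = ennreal (c ^ card K) * (\<integral>\<^sup>+w. indicator (slab K) (T w) * f (coord_proj K (T w)) \<partial>lborel)"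
    using m by (simp add: nn_integral_density nn_integral_distr nn_integral_cmult prod)
  also have "\<dots> = ennreal (c ^ card K) * (\<integral>\<^sup>+y. f (c *\<^sub>R y) \<partial>flat_lborel K)"
    by (simp add: slabT projT nn_integral_flat_lborel[OF fT])
  finally show ?thesis .
qed

text \<open>This lets identities that are known only for arguments in \<open>span K\<close> be used
  under the integral.\<close>

lemma AE_flat_lborel_span:
  shows "AE y in flat_lborel K. y \<in> span K"
proof -
  have "closed (span K)" by (simp add: closed_subspace)
  then have "{y. y \<in> span K} \<in> sets borel" by simp
  then show ?thesis
    unfolding flat_lborel_def by (subst AE_distr_iff) (auto simp: coord_proj_in_span)
qed

lemma emeasure_flat_lborel_cball:
  assumes K: "K \<subseteq> Basis"
  shows "emeasure (flat_lborel K) (cball 0 r) < \<infinity>"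
proof -
  let ?R = "\<bar>r\<bar> + 1"
  let ?C = "cbox (- (?R *\<^sub>R One)) (?R *\<^sub>R One) :: 'a set"
  have *: "w \<in> ?C" if w: "w \<in> slab K" "norm (coord_proj K w) \<le> r" for w
  proof -
    have "\<bar>w \<bullet> b\<bar> \<le> ?R" if "b \<in> Basis" for b
    proof (cases "b \<in> K")
      case True
      then have "\<bar>w \<bullet> b\<bar> \<le> norm (coord_proj K w)"
        using Basis_le_norm[OF that, of "coord_proj K w"] inner_coord_proj[OF K that] by simp
      then show ?thesis using w by simp
    next
      case False
      then have "\<bar>w \<bullet> b\<bar> \<le> 1" using w that by (auto simp: slab_def)
      then show ?thesis by simp
    qed
    then show ?thesis by (auto simp: mem_box abs_le_iff inner_diff_left) (smt (verit))+
  qed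
  have "emeasure (flat_lborel K) (cball 0 r) = (\<integral>\<^sup>+y. indicator (cball 0 r) y \<partial>flat_lborel K)"
    by simp
  also have "\<dots> = (\<integral>\<^sup>+w. indicator (slab K) w * indicator (cball 0 r) (coord_proj K w) \<partial>lborel)"
    by (rule nn_integral_flat_lborel) (auto intro: borel_measurable_indicator)
  also have "\<dots> \<le> (\<integral>\<^sup>+w. indicator ?C w \<partial>lborel)"
    by (rule nn_integral_mono) (use * in \<open>auto split: split_indicator\<close>)
  also have "\<dots> = emeasure lborel ?C" by simp
  also have "\<dots> < \<infinity>" by (rule emeasure_lborel_cbox_finite)
  finally show ?thesis .
qed

lemma emeasure_flat_lborel_ball_pos:
  assumes K: "K \<subseteq> Basis" and r: "r > 0"
  shows "emeasure (flat_lborel K) (ball 0 r) > 0"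
proof -
  let ?B = "ball (0::'a) (min 1 r)"
  have "0 < emeasure lborel ?B"
    using r less_imp_neq[OF unit_ball_vol_pos[of "real DIM('a)"]]
    by (auto simp: emeasure_ball zero_less_iff_neq_zero)
  also have "emeasure lborel ?B = (\<integral>\<^sup>+w. indicator ?B w \<partial>lborel)" by simp
  also have "\<dots> \<le> (\<integral>\<^sup>+w. indicator (slab K) w * indicator (ball 0 r) (coord_proj K w) \<partial>lborel)"
  proof (rule nn_integral_mono)
    fix w :: 'a
    have "w \<in> slab K" if "norm w < 1"
      using that Basis_le_norm[of _ w] by (force simp: slab_def)
    moreover have "norm (coord_proj K w) \<le> norm w"
      using K by (intro norm_le_componentwise) (auto simp: inner_coord_proj)
    ultimately show "indicator ?B w \<le> indicator (slab K) w * (indicator (ball 0 r) (coord_proj K w) :: ennreal)"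
      by (auto split: split_indicator)
  qed
  also have "\<dots> = (\<integral>\<^sup>+y. indicator (ball 0 r) y \<partial>flat_lborel K)"
    by (rule nn_integral_flat_lborel[symmetric]) (auto intro: borel_measurable_indicator)
  finally show ?thesis by simp
qed

lemma sigma_finite_flat_lborel:
  assumes K: "K \<subseteq> Basis"
  shows "sigma_finite_measure (flat_lborel K)"
proof
  show "\<exists>A. countable A \<and> A \<subseteq> sets (flat_lborel K) \<and> \<Union> A = space (flat_lborel K)
      \<and> (\<forall>a\<in>A. emeasure (flat_lborel K) a \<noteq> \<infinity>)"
  proof (intro exI[of _ "range (\<lambda>n. cball 0 (real n))"] conjI)
    show "\<Union> (range (\<lambda>n. cball (0::'a) (real n))) = space (flat_lborel K)"
      using real_arch_simple by auto
    show "\<forall>a\<in>range (\<lambda>n. cball 0 (real n)). emeasure (flat_lborel K) a \<noteq> \<infinity>"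
      using emeasure_flat_lborel_cball[OF K] by (auto simp: less_top)
  qed auto
qed

section \<open>Radial kernels with an exact refinement equation\<close>

text \<open>One coordinate plane is the model of all planes of dimension \<open>card K\<close>:
  radial kernels are integrated on it and carried to the other planes by isometries.\<close>

locale coord_plane =
  fixes K :: "'a::euclidean_space set"
  assumes K: "K \<subseteq> Basis" and K_ne: "K \<noteq> {}"
begin

abbreviation N :: "'a measure" where "N \<equiv> flat_lborel K"

sublocale N: sigma_finite_measure N
  by (rule sigma_finite_flat_lborel[OF K])

section \<open>Integration over the model plane, and reflections exchanging two points\<close>

lemma integrable_N:
  fixes h :: "'a \<Rightarrow> real"
  assumes h: "h \<in> borel_measurable borel" and B: "\<And>y. \<bar>h y\<bar> \<le> B"
    and r: "\<And>y. norm y > r \<Longrightarrow> h y = 0"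
  shows "integrable N h"
proof (rule integrableI_bounded_set[where A="cball 0 r" and B=B])
  show "h \<in> borel_measurable N" using h by simp
  show "emeasure N (cball 0 r) < \<infinity>" by (rule emeasure_flat_lborel_cball[OF K])
qed (use B r in auto)

lemma integral_N_distr:
  fixes h :: "'a \<Rightarrow> real"
  assumes "distr N borel S = N" "S \<in> borel_measurable borel" "h \<in> borel_measurable borel"
  shows "(\<integral>y. h (S y) \<partial>N) = (\<integral>y. h y \<partial>N)"
proof -
  have "(\<integral>y. h y \<partial>N) = (\<integral>y. h y \<partial>distr N borel S)" by (simp only: assms(1))
  also have "\<dots> = (\<integral>y. h (S y) \<partial>N)"
    by (rule integral_distr) (use assms in auto)
  finally show ?thesis by simp
qed

lemma integral_N_uminus:
  fixes h :: "'a \<Rightarrow> real"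
  assumes "h \<in> borel_measurable borel"
  shows "(\<integral>y. h (- y) \<partial>N) = (\<integral>y. h y \<partial>N)"
  by (rule integral_N_distr[OF flat_lborel_uminus]) (use assms in auto)

lemma integral_N_diff:
  fixes h :: "'a \<Rightarrow> real"
  assumes h: "h \<in> borel_measurable borel" and u: "u \<in> span K"
  shows "(\<integral>y. h (u - y) \<partial>N) = (\<integral>y. h y \<partial>N)"
proof -
  have "(\<lambda>y. h (u + y)) \<in> borel_measurable borel"
    using h by measurable
  then have "(\<integral>y. h (u + - y) \<partial>N) = (\<integral>y. h (u + y) \<partial>N)"
    by (rule integral_N_uminus)
  also have "\<dots> = (\<integral>y. h y \<partial>N)"
    by (rule integral_N_distr[OF flat_lborel_shift[OF K u]]) (use h in auto)
  finally show ?thesis by simp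
qed

lemma nn_integral_N_shift:
  fixes h :: "'a \<Rightarrow> ennreal"
  assumes h: "h \<in> borel_measurable borel" and u: "u \<in> span K"
  shows "(\<integral>\<^sup>+y. h (u + y) \<partial>N) = (\<integral>\<^sup>+y. h y \<partial>N)"
proof -
  have "(\<integral>\<^sup>+y. h y \<partial>N) = (\<integral>\<^sup>+y. h y \<partial>distr N borel ((+) u))"
    by (simp only: flat_lborel_shift[OF K u])
  also have "\<dots> = (\<integral>\<^sup>+y. h (u + y) \<partial>N)"
    by (rule nn_integral_distr) (use h in auto)
  finally show ?thesis by simp
qed

text \<open>The reflection in the perpendicular bisector of the segment from \<open>u\<close> to
  \<open>u'\<close>.\<close>

definition mirror :: "'a \<Rightarrow> 'a \<Rightarrow> 'a \<Rightarrow> 'a" where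
  "mirror u u' y = y - (2 * ((y - (1/2) *\<^sub>R (u + u')) \<bullet> (u - u')) / ((u - u') \<bullet> (u - u'))) *\<^sub>R (u - u')"

lemma measurable_mirror [measurable]: "mirror u u' \<in> borel_measurable borel"
  unfolding mirror_def[abs_def] by measurable

text \<open>The mirror is the linear reflection along \<open>u - u'\<close> followed by a
  translation along the same vector, which lies in \<open>span K\<close>; both preserve the
  measure.\<close>

lemma flat_lborel_mirror:
  assumes u: "u \<in> span K" "u' \<in> span K" "u \<noteq> u'"
  shows "distr N borel (mirror u u') = N"
proof -
  define w where "w = u - u'"
  define v where "v = (1 / norm w) *\<^sub>R w"
  have w: "w \<noteq> 0" "w \<in> span K" using u by (auto simp: w_def span_diff)
  have v: "v \<in> span K" "norm v = 1" using w by (auto simp: v_def span_scale)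
  define R where "R y = y - (2 * (y \<bullet> v)) *\<^sub>R v" for y
  define b where "b = (((u + u') \<bullet> w) / (w \<bullet> w)) *\<^sub>R w"
  have b: "b \<in> span K" using w by (simp add: b_def span_scale)
  have R [measurable]: "R \<in> borel_measurable borel"
    unfolding R_def[abs_def] by measurable
  have "w \<bullet> w \<noteq> 0" using w by simp
  then have "mirror u u' y = b + R y" for y
  proof -
    have "(y \<bullet> v) *\<^sub>R v = ((y \<bullet> w) / (w \<bullet> w)) *\<^sub>R w"
      by (simp add: v_def dot_square_norm power2_eq_square)
    then have "(2 * (y \<bullet> v)) *\<^sub>R v = (2 * ((y \<bullet> w) / (w \<bullet> w))) *\<^sub>R w"
      by (metis scaleR_scaleR)
    moreover have "2 * ((y - (1/2) *\<^sub>R (u + u')) \<bullet> w) / (w \<bullet> w)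
       = 2 * ((y \<bullet> w) / (w \<bullet> w)) - ((u + u') \<bullet> w) / (w \<bullet> w)"
      by (simp add: inner_diff_left diff_divide_distrib algebra_simps)
    ultimately show ?thesis
      unfolding mirror_def w_def[symmetric] R_def b_def by (simp add: scaleR_diff_left)
  qed
  then have eq: "mirror u u' = (+) b \<circ> R" by (simp add: fun_eq_iff)
  have "distr N borel (mirror u u') = distr (distr N borel R) borel ((+) b)"
    unfolding eq by (rule distr_distr[symmetric]) auto
  also have "\<dots> = N"
    using flat_lborel_reflection[OF K v] flat_lborel_shift[OF K b] by (simp add: R_def[abs_def])
  finally show ?thesis .
qed

lemma norm_diff_mirror:
  assumes "u \<noteq> u'"
  shows "norm (u - mirror u u' y) = norm (u' - y)" "norm (u' - mirror u u' y) = norm (u - y)"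
proof -
  define w where "w = u - u'"
  define q where "q = ((y - (1/2) *\<^sub>R (u + u')) \<bullet> w) / (w \<bullet> w)"
  have ww: "w \<bullet> w \<noteq> 0" using assms by (simp add: w_def)
  have m: "mirror u u' y = y - (2 * q) *\<^sub>R w" by (simp add: mirror_def q_def w_def)
  have qw: "q * (w \<bullet> w) = (y - (1/2) *\<^sub>R (u + u')) \<bullet> w" using ww by (simp add: q_def)
  define x where "x = u' - y"
  have q: "(1 + 2 * q) * (w \<bullet> w) = - (2 * (x \<bullet> w))"
    using qw by (simp add: x_def w_def algebra_simps inner_simps inner_commute)
  have e: "u - y = x + w" "u - mirror u u' y = x + (1 + 2 * q) *\<^sub>R w" "u' - mirror u u' y = x + (2 * q) *\<^sub>R w"
    unfolding m by (simp_all add: x_def w_def algebra_simps)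
  have n: "(norm (x + c *\<^sub>R w))\<^sup>2 = (norm x)\<^sup>2 + 2 * c * (x \<bullet> w) + c * c * (w \<bullet> w)" for c
    by (simp add: power2_norm_eq_inner inner_simps inner_commute algebra_simps)
  have "(norm (u - mirror u u' y))\<^sup>2 = (norm x)\<^sup>2 + 2 * (1 + 2 * q) * (x \<bullet> w) + (1 + 2 * q) * ((1 + 2 * q) * (w \<bullet> w))"
    unfolding e(2) n by simp
  also have "\<dots> = (norm x)\<^sup>2" unfolding q by (simp add: algebra_simps)
  finally show "norm (u - mirror u u' y) = norm (u' - y)" by (simp add: x_def)
  have "(norm (x + (2 * q) *\<^sub>R w))\<^sup>2 - (norm (x + 1 *\<^sub>R w))\<^sup>2
      = (2 * q - 1) * (2 * (x \<bullet> w)) + (2 * q - 1) * ((1 + 2 * q) * (w \<bullet> w))"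
    unfolding n by (simp add: algebra_simps)
  also have "\<dots> = 0" unfolding q by (simp add: algebra_simps)
  finally show "norm (u' - mirror u u' y) = norm (u - y)"
    unfolding e by simp
qed

text \<open>The sign of \<open>q\<close> tells on which side of the bisector \<open>y\<close> lies,
  and \<open>norm u \<le> norm u'\<close> places the origin on the side of \<open>u\<close>. So
  among \<open>y\<close> and its mirror image, the one on that side is closer both to
  \<open>u\<close> and to the origin.\<close>

lemma mirror_side:
  assumes "u \<noteq> u'" "norm u \<le> norm u'"
  shows "norm (u - y) \<le> norm (u' - y) \<and> norm y \<le> norm (mirror u u' y)
       \<or> norm (u' - y) \<le> norm (u - y) \<and> norm (mirror u u' y) \<le> norm y"
proof -
  define w where "w = u - u'"
  define q where "q = ((y - (1/2) *\<^sub>R (u + u')) \<bullet> w) / (w \<bullet> w)"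
  have ww: "w \<bullet> w > 0" using assms by (simp add: w_def)
  have m: "mirror u u' y = y - (2 * q) *\<^sub>R w" by (simp add: mirror_def q_def w_def)
  have qw: "q * (w \<bullet> w) = (y - (1/2) *\<^sub>R (u + u')) \<bullet> w" using ww by (simp add: q_def)
  have sw: "(u + u') \<bullet> w = (norm u)\<^sup>2 - (norm u')\<^sup>2"
    by (simp add: w_def power2_norm_eq_inner inner_simps inner_commute)
  then have sw_le: "(u + u') \<bullet> w \<le> 0"
    using assms(2) by (simp add: power_mono)
  then have neg: "0 \<le> - 2 * ((u + u') \<bullet> w)" by simp
  have yw: "y \<bullet> w = q * (w \<bullet> w) + ((u + u') \<bullet> w) / 2"
    using qw by (simp add: inner_diff_left)
  have "(norm (mirror u u' y))\<^sup>2 = (norm y)\<^sup>2 - 4 * q * (y \<bullet> w) + 4 * q * (q * (w \<bullet> w))"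
    unfolding m power2_norm_eq_inner by (simp add: algebra_simps inner_simps inner_commute)
  then have 1: "(norm (mirror u u' y))\<^sup>2 - (norm y)\<^sup>2 = q * (- 2 * ((u + u') \<bullet> w))"
    unfolding yw by (simp add: field_simps)
  have "(norm (u' - y))\<^sup>2 - (norm (u - y))\<^sup>2 = 2 * (y \<bullet> w) - ((norm u)\<^sup>2 - (norm u')\<^sup>2)"
    by (simp add: w_def power2_norm_eq_inner inner_simps inner_commute)
  then have 2: "(norm (u' - y))\<^sup>2 - (norm (u - y))\<^sup>2 = q * (2 * (w \<bullet> w))"
    unfolding yw sw by (simp add: field_simps)
  show ?thesis
  proof (cases "q \<ge> 0")
    case True
    have "(norm (mirror u u' y))\<^sup>2 - (norm y)\<^sup>2 \<ge> 0"
      unfolding 1 by (rule mult_nonneg_nonneg[OF True neg])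
    moreover have "(norm (u' - y))\<^sup>2 - (norm (u - y))\<^sup>2 \<ge> 0"
      unfolding 2 using True ww by simp
    ultimately show ?thesis by (auto intro!: disjI1 power2_le_imp_le)
  next
    case False
    have "(norm (mirror u u' y))\<^sup>2 - (norm y)\<^sup>2 \<le> 0"
      unfolding 1 by (rule mult_nonpos_nonneg[OF _ neg]) (use False in simp)
    moreover have "(norm (u' - y))\<^sup>2 - (norm (u - y))\<^sup>2 \<le> 0"
      unfolding 2 by (rule mult_nonpos_nonneg) (use False ww in auto)
    ultimately show ?thesis by (auto intro!: disjI2 power2_le_imp_le)
  qed
qed

section \<open>Radial profiles and their convolution\<close>

definition profile :: "real \<Rightarrow> real \<Rightarrow> (real \<Rightarrow> real) \<Rightarrow> bool" where
  "profile B R g \<longleftrightarrow> g \<in> borel_measurable borel \<and> (\<forall>s. 0 \<le> g s \<and> g s \<le> B) \<and>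
     (\<forall>s t. 0 \<le> s \<longrightarrow> s \<le> t \<longrightarrow> g t \<le> g s) \<and> (\<forall>s. s \<ge> R \<longrightarrow> g s = 0)"

lemma profileD:
  assumes "profile B R g"
  shows "g \<in> borel_measurable borel" "0 \<le> g s" "g s \<le> B" "0 \<le> s \<Longrightarrow> s \<le> t \<Longrightarrow> g t \<le> g s"
    "s \<ge> R \<Longrightarrow> g s = 0"
  using assms by (auto simp: profile_def)

lemma measurable_profile_norm:
  assumes "profile B R g" "h \<in> borel_measurable M"
  shows "(\<lambda>y. g (norm (h y :: 'a))) \<in> borel_measurable M"
proof -
  have "(\<lambda>y. norm (h y)) \<in> borel_measurable M" using assms(2) by measurable
  then show ?thesis by (rule measurable_compose[OF _ profileD(1)[OF assms(1)]])
qed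

lemma integrable_profile:
  assumes g: "profile B R g"
  shows "integrable N (\<lambda>y. g (norm y))"
  by (rule integrable_N[where B=B and r=R])
     (use profileD[OF g] measurable_profile_norm[OF g] in auto)

lemma integrable_profile_mult:
  assumes p: "profile B R p" and g: "profile B' R' g" and h: "h \<in> borel_measurable borel"
  shows "integrable N (\<lambda>y. p (norm y) * g (norm (h y :: 'a)))"
proof (rule integrable_N[where B="B * B'" and r=R])
  show "(\<lambda>y. p (norm y) * g (norm (h y))) \<in> borel_measurable borel"
    by (intro borel_measurable_times measurable_profile_norm[OF p] measurable_profile_norm[OF g] h) simp
  show "\<bar>p (norm y) * g (norm (h y))\<bar> \<le> B * B'" for y
    using profileD(2,3)[OF p, of "norm y"] profileD(2,3)[OF g, of "norm (h y)"]
    by (simp add: abs_mult mult_mono)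
qed (use profileD(5)[OF p] in auto)

text \<open>Symmetrising over the mirror that exchanges \<open>u\<close> and \<open>u'\<close> turns the difference of the two
  sides into the integral of a product of two factors of the same sign.\<close>

lemma conv_profile_mono:
  assumes p: "profile B R p" and g: "profile B' R' g"
    and u: "u \<in> span K" "u' \<in> span K" "norm u \<le> norm u'"
  shows "(\<integral>y. p (norm y) * g (norm (u' - y)) \<partial>N) \<le> (\<integral>y. p (norm y) * g (norm (u - y)) \<partial>N)"
proof (cases "u = u'")
  case False
  let ?r = "mirror u u'"
  define a where "a y = p (norm y)" for y :: 'a
  define b where "b y = g (norm (u - y)) - g (norm (u' - y))" for y
  note ar = norm_diff_mirror[OF False]
  have br: "b (?r y) = - b y" for y by (simp add: b_def ar)
  have int: "integrable N (\<lambda>y. p (norm y) * g (norm (u - y)))" for u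
    by (rule integrable_profile_mult[OF p g]) measurable
  have eq: "a y * b y = p (norm y) * g (norm (u - y)) - p (norm y) * g (norm (u' - y))" for y
    by (simp add: a_def b_def algebra_simps)
  have iab: "integrable N (\<lambda>y. a y * b y)"
    unfolding eq by (intro Bochner_Integration.integrable_diff int)
  have mab: "(\<lambda>y. a y * b y) \<in> borel_measurable borel"
    using borel_measurable_integrable[OF iab] by simp
  have "(\<integral>y. a (?r y) * b (?r y) \<partial>N) = (\<integral>y. a y * b y \<partial>N)"
    by (rule integral_N_distr[OF flat_lborel_mirror[OF u(1,2) False]]) (use mab in auto)
  then have sym: "(\<integral>y. - (a (?r y) * b y) \<partial>N) = (\<integral>y. a y * b y \<partial>N)"
    by (simp add: br)
  have iab': "integrable N (\<lambda>y. - (a (?r y) * b y))"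
  proof -
    have "integrable (distr N borel ?r) (\<lambda>y. a y * b y)"
      unfolding flat_lborel_mirror[OF u(1,2) False] by (rule iab)
    then have "integrable N (\<lambda>y. a (?r y) * b (?r y))"
      by (subst (asm) integrable_distr_eq) (use mab in auto)
    then show ?thesis by (simp add: br)
  qed
  have "2 * (\<integral>y. a y * b y \<partial>N) = (\<integral>y. a y * b y + - (a (?r y) * b y) \<partial>N)"
    using sym by (subst Bochner_Integration.integral_add[OF iab iab']) simp
  also have "\<dots> = (\<integral>y. (a y - a (?r y)) * b y \<partial>N)"
    by (rule Bochner_Integration.integral_cong) (auto simp: algebra_simps)
  also have "\<dots> \<ge> 0"
  proof (rule Bochner_Integration.integral_nonneg)
    fix y
    show "0 \<le> (a y - a (?r y)) * b y"
      using mirror_side[OF False u(3), of y] profileD(4)[OF p] profileD(4)[OF g]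
      by (auto simp: a_def b_def intro: mult_nonneg_nonneg mult_nonpos_nonpos)
  qed
  finally have "0 \<le> (\<integral>y. a y * b y \<partial>N)" by simp
  then show ?thesis
    unfolding eq by (subst (asm) Bochner_Integration.integral_diff[OF int int]) simp
qed simp

definition unit_vec :: 'a where "unit_vec = (SOME b. b \<in> K)"

lemma unit_vec: "unit_vec \<in> K" "norm unit_vec = 1" "s *\<^sub>R unit_vec \<in> span K"
proof -
  show "unit_vec \<in> K" using K_ne by (auto simp: unit_vec_def intro: someI)
  then show "norm unit_vec = 1" "s *\<^sub>R unit_vec \<in> span K"
    using K by (auto intro: span_scale span_base)
qed

text \<open>Convolution on \<open>span K\<close> of two radial functions, read off along the ray
  through \<open>unit_vec\<close>; by \<open>conv_eq\<close> every other ray gives the same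
  values.\<close>

definition conv :: "(real \<Rightarrow> real) \<Rightarrow> (real \<Rightarrow> real) \<Rightarrow> real \<Rightarrow> real" where
  "conv p g s = (\<integral>y. p (norm y) * g (norm (s *\<^sub>R unit_vec - y)) \<partial>N)"

text \<open>Rotation invariance is a by-product of monotonicity: two points of equal norm are
  compared by \<open>conv_profile_mono\<close> in both directions.\<close>

lemma conv_eq:
  assumes p: "profile B R p" and g: "profile B' R' g" and u: "u \<in> span K"
  shows "(\<integral>y. p (norm y) * g (norm (u - y)) \<partial>N) = conv p g (norm u)"
  unfolding conv_def
  by (intro antisym conv_profile_mono[OF p g]) (use u unit_vec in auto)

lemma conv_antimono:
  assumes p: "profile B R p" and g: "profile B' R' g" and s: "0 \<le> s" "s \<le> t"
  shows "conv p g t \<le> conv p g s"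
  unfolding conv_def using s unit_vec by (intro conv_profile_mono[OF p g]) auto

lemma conv_swap:
  assumes p: "profile B R p" and g: "profile B' R' g"
  shows "conv p g s = (\<integral>y. p (norm (s *\<^sub>R unit_vec - y)) * g (norm y) \<partial>N)"
proof -
  have "(\<lambda>y. p (norm y) * g (norm (s *\<^sub>R unit_vec - y))) \<in> borel_measurable borel"
    by (intro borel_measurable_times measurable_profile_norm[OF p] measurable_profile_norm[OF g])
       measurable
  from integral_N_diff[OF this unit_vec(3)[of s]] show ?thesis
    by (simp add: conv_def)
qed

lemma conv_nonneg:
  assumes p: "profile B R p" and g: "profile B' R' g"
  shows "0 \<le> conv p g s"
  unfolding conv_def using profileD(2)[OF p] profileD(2)[OF g] by simp

lemma conv_le:
  assumes p: "profile B R p" and g: "profile B' R' g" and 1: "(\<integral>y. g (norm y) \<partial>N) = 1"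
  shows "conv p g s \<le> B"
proof -
  have "conv p g s \<le> (\<integral>y. B * g (norm y) \<partial>N)"
    unfolding conv_swap[OF p g]
  proof (rule integral_mono)
    have "integrable N (\<lambda>y. g (norm y) * p (norm (s *\<^sub>R unit_vec - y)))"
      by (rule integrable_profile_mult[OF g p]) measurable
    then show "integrable N (\<lambda>y. p (norm (s *\<^sub>R unit_vec - y)) * g (norm y))"
      by (simp add: mult.commute)
    show "integrable N (\<lambda>y. B * g (norm y))" using integrable_profile[OF g] by simp
    show "p (norm (s *\<^sub>R unit_vec - y)) * g (norm y) \<le> B * g (norm y)" for y
      using profileD(3)[OF p] profileD(2)[OF g] by (simp add: mult_right_mono)
  qed
  also have "\<dots> = B" by (simp add: 1)
  finally show ?thesis .
qed

lemma conv_support: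
  assumes p: "profile B R p" and g: "profile B' R' g" and s: "s \<ge> R + R'"
  shows "conv p g s = 0"
proof -
  have "p (norm y) * g (norm (s *\<^sub>R unit_vec - y)) = 0" for y
  proof (cases "norm y \<ge> R")
    case True
    then show ?thesis using profileD(5)[OF p] by simp
  next
    case False
    have "norm (s *\<^sub>R unit_vec) \<le> norm y + norm (s *\<^sub>R unit_vec - y)"
      using norm_triangle_ineq[of y "s *\<^sub>R unit_vec - y"] by simp
    then have "norm (s *\<^sub>R unit_vec - y) \<ge> R'"
      using False s unit_vec(2) by simp
    then show ?thesis using profileD(5)[OF g] by simp
  qed
  then show ?thesis unfolding conv_def by (simp only:) simp
qed

lemma measurable_conv:
  assumes p: "profile B R p" and g: "profile B' R' g"
  shows "conv p g \<in> borel_measurable borel"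
  unfolding conv_def[abs_def]
proof (rule N.borel_measurable_lebesgue_integral)
  have "(\<lambda>x. p (norm (snd x)) * g (norm (fst x *\<^sub>R unit_vec - snd x))) \<in> borel_measurable (borel \<Otimes>\<^sub>M N)"
    by (intro borel_measurable_times measurable_profile_norm[OF p] measurable_profile_norm[OF g])
       measurable
  then show "(\<lambda>(x, y). p (norm y) * g (norm (x *\<^sub>R unit_vec - y))) \<in> borel_measurable (borel \<Otimes>\<^sub>M N)"
    by (simp add: split_beta')
qed

text \<open>The height bound is inherited from \<open>p\<close> alone because \<open>g\<close> is a
  probability density, while the radii add. This asymmetry keeps the iterated convolutions uniformly
  bounded even though the narrow factors are tall.\<close>

lemma profile_conv:
  assumes p: "profile B R p" and g: "profile B' R' g" and 1: "(\<integral>y. g (norm y) \<partial>N) = 1"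
  shows "profile B (R + R') (conv p g)"
  using measurable_conv[OF p g] conv_nonneg[OF p g] conv_le[OF p g 1] conv_antimono[OF p g]
    conv_support[OF p g]
  by (auto simp: profile_def)

lemma integral_conv:
  assumes p: "profile B R p" and g: "profile B' R' g"
    and 1: "(\<integral>y. p (norm y) \<partial>N) = 1" "(\<integral>y. g (norm y) \<partial>N) = 1"
  shows "(\<integral>y. conv p g (norm y) \<partial>N) = 1"
proof -
  interpret NN: pair_sigma_finite N N ..
  have nn1: "(\<integral>\<^sup>+y. ennreal (h (norm y)) \<partial>N) = 1" if "profile B'' R'' h" "(\<integral>y. h (norm y) \<partial>N) = 1" for h B'' R''
    using that profileD(2)[OF that(1)]
    by (subst nn_integral_eq_integral[OF integrable_profile[OF that(1)]]) auto
  have mg: "(\<lambda>y::'a. g (norm y)) \<in> borel_measurable borel"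
    using measurable_profile_norm[OF g, of "\<lambda>y. y" borel] by simp
  have m2: "(\<lambda>x. ennreal (p (norm (fst x)) * g (norm (snd x - fst x)))) \<in> borel_measurable (N \<Otimes>\<^sub>M N)"
    by (intro measurable_compose[OF _ measurable_ennreal] borel_measurable_times
        measurable_profile_norm[OF p] measurable_profile_norm[OF g]) measurable
  have "(\<integral>\<^sup>+u. ennreal (conv p g (norm u)) \<partial>N)
      = (\<integral>\<^sup>+u. (\<integral>\<^sup>+y. ennreal (p (norm y) * g (norm (u - y))) \<partial>N) \<partial>N)"
  proof (rule nn_integral_cong_AE)
    show "AE u in N. ennreal (conv p g (norm u)) = (\<integral>\<^sup>+y. ennreal (p (norm y) * g (norm (u - y))) \<partial>N)"
      using AE_flat_lborel_span
    proof eventually_elim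
      case (elim u)
      have "integrable N (\<lambda>y. p (norm y) * g (norm (u - y)))"
        by (rule integrable_profile_mult[OF p g]) measurable
      then show ?case
        using profileD(2)[OF p] profileD(2)[OF g]
        by (subst nn_integral_eq_integral) (auto simp: conv_eq[OF p g elim])
    qed
  qed
  also have "\<dots> = (\<integral>\<^sup>+y. (\<integral>\<^sup>+u. ennreal (p (norm y) * g (norm (u - y))) \<partial>N) \<partial>N)"
    by (rule NN.Fubini') (use m2 in \<open>simp add: split_beta'\<close>)
  also have "\<dots> = (\<integral>\<^sup>+y. ennreal (p (norm y)) \<partial>N)"
  proof (rule nn_integral_cong_AE)
    show "AE y in N. (\<integral>\<^sup>+u. ennreal (p (norm y) * g (norm (u - y))) \<partial>N) = ennreal (p (norm y))"
      using AE_flat_lborel_span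
    proof eventually_elim
      case (elim y)
      have m: "(\<lambda>u::'a. ennreal (g (norm u))) \<in> borel_measurable borel"
        by (rule measurable_compose[OF mg measurable_ennreal])
      have "(\<integral>\<^sup>+u. ennreal (p (norm y) * g (norm (u - y))) \<partial>N)
          = (\<integral>\<^sup>+u. ennreal (p (norm y)) * ennreal (g (norm (- y + u))) \<partial>N)"
        using profileD(2)[OF p] profileD(2)[OF g] by (simp add: ennreal_mult)
      also have "\<dots> = ennreal (p (norm y)) * (\<integral>\<^sup>+u. ennreal (g (norm (- y + u))) \<partial>N)"
        by (intro nn_integral_cmult measurable_compose[OF _ measurable_ennreal] measurable_profile_norm[OF g])
           measurable
      also have "(\<integral>\<^sup>+u. ennreal (g (norm (- y + u))) \<partial>N) = (\<integral>\<^sup>+u. ennreal (g (norm u)) \<partial>N)"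
        by (rule nn_integral_N_shift[OF m]) (use elim in \<open>simp add: span_neg\<close>)
      finally show ?case using nn1[OF g 1(2)] by simp
    qed
  qed
  also have "\<dots> = 1" by (rule nn1[OF p 1(1)])
  finally have "(\<integral>\<^sup>+u. ennreal (conv p g (norm u)) \<partial>N) = 1" .
  moreover have "(\<lambda>u. conv p g (norm u)) \<in> borel_measurable N"
    by (rule measurable_compose[OF _ measurable_conv[OF p g]]) simp
  ultimately show ?thesis
    using conv_nonneg[OF p g] by (subst integral_eq_nn_integral) auto
qed


section \<open>The paraboloid bump and its iterated convolutions\<close>

definition height :: real where
  "height = 1 / (\<integral>y. max 0 (1 - (norm y)\<^sup>2) \<partial>N)"

text \<open>A function of \<open>s\<^sup>2\<close> with slope at most \<open>height\<close> in
  absolute value; this is the Lipschitz bound that \<open>kern_diff_le\<close> passes on to all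
  convolutions.\<close>

definition bump :: "real \<Rightarrow> real" where
  "bump s = height * max 0 (1 - s\<^sup>2)"

definition dilate :: "(real \<Rightarrow> real) \<Rightarrow> real \<Rightarrow> real" where
  "dilate g s = 4 ^ card K * g (4 * s)"

text \<open>The convolution of bumps of widths 1, 1/4, ..., 4^-m, each of integral 1. Splitting off
  the widest factor is the refinement equation, which is thus true by construction and involves no
  limit.\<close>

primrec kern :: "nat \<Rightarrow> real \<Rightarrow> real" where
  "kern 0 = bump"
| "kern (Suc m) = conv bump (dilate (kern m))"

lemma integrable_paraboloid: "integrable N (\<lambda>y. max 0 (1 - (norm y)\<^sup>2))"
proof (rule integrable_N[where B=1 and r=1])
  show "max 0 (1 - (norm y)\<^sup>2) = 0" if "norm y > 1" for y :: 'a
    using that one_le_power[of "norm y" 2] by simp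
qed auto

text \<open>The normalising integral is finite and positive, because the paraboloid is at least 3/4
  on the ball of radius 1/2, which has positive finite measure.\<close>

lemma height_pos: "height > 0"
proof -
  let ?B = "ball (0::'a) (1/2)"
  have "emeasure N ?B \<le> emeasure N (cball 0 (1/2))" by (rule emeasure_mono) auto
  then have "emeasure N ?B < top"
    using emeasure_flat_lborel_cball[OF K, of "1/2"] by (metis infinity_ennreal_def le_less_trans)
  then have "measure N ?B > 0"
    using emeasure_flat_lborel_ball_pos[OF K, of "1/2"] by (simp add: measure_def enn2real_positive_iff)
  then have "(0::real) < (\<integral>y. 3 / 4 * indicator ?B y \<partial>N)"
    by simp
  also have "\<dots> \<le> (\<integral>y. max 0 (1 - (norm y)\<^sup>2) \<partial>N)"
  proof (rule integral_mono)
    show "integrable N (\<lambda>y. 3 / 4 * indicator (ball (0::'a) (1/2)) y :: real)"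
      by (rule integrable_N[where B=1 and r=1]) (auto simp: indicator_def)
    fix y :: 'a
    show "3 / 4 * indicator (ball 0 (1/2)) y \<le> max 0 (1 - (norm y)\<^sup>2)"
    proof (cases "norm y < 1/2")
      case True
      then have "(norm y)\<^sup>2 \<le> (1/2)\<^sup>2" by (intro power_mono) auto
      then show ?thesis by (simp add: indicator_def power2_eq_square)
    qed (simp add: indicator_def)
  qed (rule integrable_paraboloid)
  finally show ?thesis by (simp add: height_def)
qed

lemma profile_bump: "profile height 1 bump"
proof -
  have "bump t \<le> bump s" if "0 \<le> s" "s \<le> t" for s t
  proof -
    have "s\<^sup>2 \<le> t\<^sup>2" using that by (intro power_mono)
    then show ?thesis
      unfolding bump_def using height_pos by (intro mult_left_mono) auto
  qed
  moreover have "bump s = 0" if "s \<ge> 1" for s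
    using that one_le_power[of s 2] by (simp add: bump_def)
  moreover have "bump s \<le> height" for s
    unfolding bump_def using height_pos mult_left_mono[of "max 0 (1 - s\<^sup>2)" 1 height] by simp
  moreover have "bump \<in> borel_measurable borel"
    unfolding bump_def[abs_def] by measurable
  ultimately show ?thesis
    using height_pos by (simp add: profile_def bump_def)
qed

lemma integral_bump: "(\<integral>y. bump (norm y) \<partial>N) = 1"
  using height_pos by (simp add: bump_def height_def)

lemma profile_dilate:
  assumes "profile B R g"
  shows "profile (4 ^ card K * B) (R / 4) (dilate g)"
proof -
  have "(\<lambda>s. 4 ^ card K * g (4 * s)) \<in> borel_measurable borel"
    using measurable_compose[OF _ profileD(1)[OF assms], of "\<lambda>s. 4 * s" borel] by simp
  then show ?thesis
    using profileD(2-5)[OF assms]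
    by (auto simp: profile_def dilate_def[abs_def])
qed

lemma integral_dilate:
  assumes g: "profile B R g"
  shows "(\<integral>y. dilate g (norm y) \<partial>N) = (\<integral>y. g (norm y) \<partial>N)"
proof -
  have nn: "(\<integral>\<^sup>+y. ennreal (h (norm y)) \<partial>N) = ennreal (\<integral>y. h (norm y) \<partial>N)"
    if "profile B' R' h" for h B' R'
    using profileD(2)[OF that]
    by (subst nn_integral_eq_integral[OF integrable_profile[OF that]]) auto
  have "(\<lambda>y::'a. ennreal (g (norm y))) \<in> borel_measurable borel"
    using measurable_profile_norm[OF g, of "\<lambda>y. y" borel] by simp
  from nn_integral_flat_lborel_scale[OF K _ this, of 4]
  have "ennreal (\<integral>y. g (norm y) \<partial>N) = ennreal (4 ^ card K) * (\<integral>\<^sup>+y. ennreal (g (norm (4 *\<^sub>R y))) \<partial>N)"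
    by (simp add: nn[OF g])
  also have "\<dots> = (\<integral>\<^sup>+y. ennreal (4 ^ card K) * ennreal (g (norm (4 *\<^sub>R y))) \<partial>N)"
    using measurable_profile_norm[OF g, of "\<lambda>y. 4 *\<^sub>R y" borel] by (intro nn_integral_cmult[symmetric]) simp
  also have "\<dots> = (\<integral>\<^sup>+y. ennreal (dilate g (norm y)) \<partial>N)"
    using profileD(2)[OF g] by (simp add: dilate_def ennreal_mult)
  also have "\<dots> = ennreal (\<integral>y. dilate g (norm y) \<partial>N)"
    by (rule nn[OF profile_dilate[OF g]])
  finally show ?thesis
    using profileD(2)[OF g] profileD(2)[OF profile_dilate[OF g]] by (simp add: integral_nonneg)
qed

text \<open>The radius 4/3 is the fixed point of R = 1 + R/4, that is, the sum of the widths 1 + 1/4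
  + 1/16 + ...; the height does not grow by \<open>profile_conv\<close>.\<close>

lemma profile_kern_aux: "profile height (4/3) (kern m) \<and> (\<integral>y. kern m (norm y) \<partial>N) = 1"
proof (induction m)
  case 0
  have "profile height (4/3) bump" using profile_bump by (simp add: profile_def)
  then show ?case using integral_bump by simp
next
  case (Suc m)
  then have d: "profile (4 ^ card K * height) (1/3) (dilate (kern m))"
      "(\<integral>y. dilate (kern m) (norm y) \<partial>N) = 1"
    using profile_dilate[of height "4/3" "kern m"] integral_dilate[of height "4/3" "kern m"] by auto
  show ?case
    using profile_conv[OF profile_bump d] integral_conv[OF profile_bump d(1) integral_bump d(2)] by simp
qed

lemma profile_kern: "profile height (4/3) (kern m)"
  and integral_kern: "(\<integral>y. kern m (norm y) \<partial>N) = 1"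
  using profile_kern_aux by auto

lemma profile_dilate_kern: "profile (4 ^ card K * height) (1/3) (dilate (kern m))"
  using profile_dilate[OF profile_kern, of m] by simp

lemma integral_dilate_kern: "(\<integral>y. dilate (kern m) (norm y) \<partial>N) = 1"
  by (simp add: integral_dilate[OF profile_kern] integral_kern)

lemma kern_eq_integral:
  assumes "u \<in> span K"
  shows "kern (Suc m) (norm u) = (\<integral>y. bump (norm y) * dilate (kern m) (norm (u - y)) \<partial>N)"
  by (simp add: conv_eq[OF profile_bump profile_dilate_kern assms])

text \<open>The narrow factor is a probability density supported in radius 1/3, so the bump is
  averaged over arguments of norm at most 2/3, where it is at least (1 - 4/9)
  \<open>height\<close>.\<close>

lemma kern_lower:
  assumes s: "0 \<le> s" "s \<le> 1/3"
  shows "5/9 * height \<le> kern m s"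
proof -
  have *: "5/9 * height \<le> bump t" if "0 \<le> t" "t \<le> 2/3" for t
  proof -
    have "t\<^sup>2 \<le> (2/3)\<^sup>2" using that by (intro power_mono)
    then have "5/9 \<le> max 0 (1 - t\<^sup>2)" by (simp add: power_divide)
    then have "height * (5/9) \<le> bump t"
      unfolding bump_def by (rule mult_left_mono) (use height_pos in simp)
    then show ?thesis by simp
  qed
  show ?thesis
  proof (cases m)
    case 0
    then show ?thesis using *[of s] s by simp
  next
    case (Suc l)
    let ?g = "dilate (kern l)"
    note g = profile_dilate_kern[of l]
    have "5/9 * height = (\<integral>y. 5/9 * height * ?g (norm y) \<partial>N)"
      by (simp add: integral_dilate_kern)
    also have "\<dots> \<le> (\<integral>y. bump (norm (s *\<^sub>R unit_vec - y)) * ?g (norm y) \<partial>N)"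
    proof (rule integral_mono)
      show "integrable N (\<lambda>y. 5/9 * height * ?g (norm y))" using integrable_profile[OF g] by simp
      have "integrable N (\<lambda>y. ?g (norm y) * bump (norm (s *\<^sub>R unit_vec - y)))"
        by (rule integrable_profile_mult[OF g profile_bump]) measurable
      then show "integrable N (\<lambda>y. bump (norm (s *\<^sub>R unit_vec - y)) * ?g (norm y))"
        by (simp add: mult.commute)
      fix y
      show "5/9 * height * ?g (norm y) \<le> bump (norm (s *\<^sub>R unit_vec - y)) * ?g (norm y)"
      proof (cases "norm y \<ge> 1/3")
        case True
        then show ?thesis using profileD(5)[OF g] by simp
      next
        case False
        have "norm (s *\<^sub>R unit_vec - y) \<le> 2/3"
          using norm_triangle_ineq4[of "s *\<^sub>R unit_vec" y] False s unit_vec(2) by simp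
        then show ?thesis
          using *[of "norm (s *\<^sub>R unit_vec - y)"] profileD(2)[OF g] by (intro mult_right_mono) auto
      qed
    qed
    also have "\<dots> = kern m s" by (simp add: Suc conv_swap[OF profile_bump g])
    finally show ?thesis .
  qed
qed

text \<open>For fixed \<open>A\<close> the left-hand side is a convex even function of \<open>x\<close>.\<close>

lemma paraboloid_sum_le:
  fixes A A' x x' :: real
  assumes "\<bar>x\<bar> \<le> \<bar>x'\<bar>" "A \<le> A'"
  shows "max 0 (1 - (A - x)) + max 0 (1 - (A + x))
    \<le> max 0 (1 - (A' - x')) + max 0 (1 - (A' + x')) + 2 * (A' - A)"
  using assms by (auto simp: max_def abs_if split: if_splits)

text \<open>In |s e - y|^2 the term linear in \<open>y\<close> would spoil a pointwise comparison of
  \<open>s\<close> with \<open>t\<close>. The narrow factor is even, so \<open>y\<close> may be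
  averaged with \<open>- y\<close>, and \<open>paraboloid_sum_le\<close> then compares the two
  pairs, with \<open>A = s\<^sup>2 + q\<close> and \<open>x = 2 * s * b\<close>.\<close>

lemma kern_diff_le:
  assumes s: "0 \<le> s" "s \<le> t"
  shows "kern m s \<le> kern m t + height * (t\<^sup>2 - s\<^sup>2)"
proof -
  have st: "s\<^sup>2 \<le> t\<^sup>2" using s by (intro power_mono)
  show ?thesis
  proof (cases m)
    case 0
    have "max 0 (1 - s\<^sup>2) \<le> max 0 (1 - t\<^sup>2) + (t\<^sup>2 - s\<^sup>2)" using st by auto
    then have "bump s \<le> height * (max 0 (1 - t\<^sup>2) + (t\<^sup>2 - s\<^sup>2))"
      unfolding bump_def using height_pos by (intro mult_left_mono) auto
    then show ?thesis by (simp add: 0 bump_def algebra_simps)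
  next
    case (Suc l)
    let ?g = "dilate (kern l)"
    let ?p = "\<lambda>r y. bump (norm (r *\<^sub>R unit_vec - y))"
    note g = profile_dilate_kern[of l]
    have ig: "integrable N (\<lambda>y. ?g (norm y) * bump (norm (h y)))" if "h \<in> borel_measurable borel" for h :: "'a \<Rightarrow> 'a"
      by (rule integrable_profile_mult[OF g profile_bump that])
    have i1: "integrable N (\<lambda>y. ?p r y * ?g (norm y))" for r
      using ig[of "\<lambda>y. r *\<^sub>R unit_vec - y"] by (simp add: mult.commute)
    have i2: "integrable N (\<lambda>y. ?p r (- y) * ?g (norm y))" for r
      using ig[of "\<lambda>y. r *\<^sub>R unit_vec - (- y)"] by (simp add: mult.commute)
    have sym: "2 * kern m r = (\<integral>y. (?p r y + ?p r (- y)) * ?g (norm y) \<partial>N)" for r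
    proof -
      have m: "(\<lambda>y. ?p r y * ?g (norm y)) \<in> borel_measurable borel"
        using borel_measurable_integrable[OF i1] by simp
      have "(\<integral>y. ?p r (- y) * ?g (norm y) \<partial>N) = (\<integral>y. ?p r y * ?g (norm y) \<partial>N)"
        using integral_N_uminus[OF m] by simp
      then have "2 * kern m r = (\<integral>y. ?p r y * ?g (norm y) \<partial>N) + (\<integral>y. ?p r (- y) * ?g (norm y) \<partial>N)"
        by (simp add: Suc conv_swap[OF profile_bump g])
      also have "\<dots> = (\<integral>y. ?p r y * ?g (norm y) + ?p r (- y) * ?g (norm y) \<partial>N)"
        by (rule Bochner_Integration.integral_add[OF i1 i2, symmetric])
      finally show ?thesis by (simp add: distrib_right)
    qed
    have pt: "?p s y + ?p s (- y) \<le> ?p t y + ?p t (- y) + height * (2 * (t\<^sup>2 - s\<^sup>2))" for y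
    proof -
      define q b where "q = (norm y)\<^sup>2" and "b = y \<bullet> unit_vec"
      have n1: "(norm (r *\<^sub>R unit_vec - y))\<^sup>2 = (r\<^sup>2 + q) - 2 * r * b" for r
      proof -
        have "unit_vec \<bullet> unit_vec = 1" using unit_vec(2) by (simp add: dot_square_norm)
        then show ?thesis
          unfolding q_def b_def power2_norm_eq_inner
          by (simp add: inner_simps inner_commute algebra_simps power2_eq_square)
      qed
      have n2: "(norm (r *\<^sub>R unit_vec + y))\<^sup>2 = (r\<^sup>2 + q) + 2 * r * b" for r
      proof -
        have "unit_vec \<bullet> unit_vec = 1" using unit_vec(2) by (simp add: dot_square_norm)
        then show ?thesis
          unfolding q_def b_def power2_norm_eq_inner
          by (simp add: inner_simps inner_commute algebra_simps power2_eq_square)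
      qed
      have "\<bar>2 * s * b\<bar> \<le> \<bar>2 * t * b\<bar>" using s by (simp add: abs_mult mult_right_mono)
      then have "height * (max 0 (1 - ((s\<^sup>2 + q) - 2 * s * b)) + max 0 (1 - ((s\<^sup>2 + q) + 2 * s * b)))
        \<le> height * (max 0 (1 - ((t\<^sup>2 + q) - 2 * t * b)) + max 0 (1 - ((t\<^sup>2 + q) + 2 * t * b)) + 2 * ((t\<^sup>2 + q) - (s\<^sup>2 + q)))"
        using st height_pos by (intro mult_left_mono paraboloid_sum_le) auto
      then show ?thesis by (simp add: bump_def n1 n2) (simp add: algebra_simps)
    qed
    have "2 * kern m s \<le> (\<integral>y. (?p t y + ?p t (- y)) * ?g (norm y) + height * (2 * (t\<^sup>2 - s\<^sup>2)) * ?g (norm y) \<partial>N)"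
      unfolding sym
    proof (rule integral_mono)
      show "integrable N (\<lambda>y. (?p s y + ?p s (- y)) * ?g (norm y))"
        using Bochner_Integration.integrable_add[OF i1 i2] by (simp add: distrib_right)
      show "integrable N (\<lambda>y. (?p t y + ?p t (- y)) * ?g (norm y) + height * (2 * (t\<^sup>2 - s\<^sup>2)) * ?g (norm y))"
        using Bochner_Integration.integrable_add[OF Bochner_Integration.integrable_add[OF i1 i2]
          integrable_mult_right[OF integrable_profile[OF g]]] by (simp add: distrib_right)
      show "(?p s y + ?p s (- y)) * ?g (norm y)
          \<le> (?p t y + ?p t (- y)) * ?g (norm y) + height * (2 * (t\<^sup>2 - s\<^sup>2)) * ?g (norm y)" for y
        using mult_right_mono[OF pt[of y] profileD(2)[OF g, of "norm y"]] by (simp add: distrib_right)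
    qed
    also have "\<dots> = (\<integral>y. (?p t y + ?p t (- y)) * ?g (norm y) \<partial>N)
        + (\<integral>y. height * (2 * (t\<^sup>2 - s\<^sup>2)) * ?g (norm y) \<partial>N)"
    proof (rule Bochner_Integration.integral_add)
      show "integrable N (\<lambda>y. (?p t y + ?p t (- y)) * ?g (norm y))"
        using Bochner_Integration.integrable_add[OF i1 i2] by (simp add: distrib_right)
      show "integrable N (\<lambda>y. height * (2 * (t\<^sup>2 - s\<^sup>2)) * ?g (norm y))"
        by (rule integrable_mult_right[OF integrable_profile[OF g]])
    qed
    also have "\<dots> = 2 * kern m t + height * (2 * (t\<^sup>2 - s\<^sup>2))"
      using sym[of t] by (simp add: integral_dilate_kern)
    finally show ?thesis by (simp add: algebra_simps)
  qed
qed

text \<open>The refinement equation with the narrow kernel evaluated off the plane, at height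
  \<open>d\<close> over it. By \<open>kern_diff_le\<close> the offset costs a multiple of
  \<open>d\<^sup>2\<close>; the factors 16 and \<open>4 ^ card K\<close> come from the rescaling in
  \<open>dilate\<close>.\<close>

lemma kern_Suc_le:
  assumes u: "u \<in> span K" "norm u \<le> a"
    and h: "h \<in> borel_measurable borel" and hd: "\<And>y. y \<in> span K \<Longrightarrow> h y = sqrt ((norm (u - y))\<^sup>2 + d\<^sup>2)"
  shows "kern (Suc m) a \<le> (\<integral>y. bump (norm y) * dilate (kern m) (h y) \<partial>N) + 16 * 4 ^ card K * height * d\<^sup>2"
proof -
  let ?e = "16 * 4 ^ card K * height * d\<^sup>2"
  have i1: "integrable N (\<lambda>y. bump (norm y) * dilate (kern m) (norm (u - y)))"
    by (rule integrable_profile_mult[OF profile_bump profile_dilate_kern]) measurable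
  have "(\<lambda>y. bump (norm y) * dilate (kern m) (h y)) \<in> borel_measurable borel"
    using measurable_compose[OF h profileD(1)[OF profile_dilate_kern]]
      measurable_profile_norm[OF profile_bump, of "\<lambda>y::'a. y" borel] by measurable
  then have i2: "integrable N (\<lambda>y. bump (norm y) * dilate (kern m) (h y))"
  proof (rule integrable_N[where B="height * (4 ^ card K * height)" and r=1])
    show "\<bar>bump (norm y) * dilate (kern m) (h y)\<bar> \<le> height * (4 ^ card K * height)" for y
      using profileD(2,3)[OF profile_bump, of "norm y"] profileD(2,3)[OF profile_dilate_kern[of m], of "h y"] height_pos
      by (simp add: abs_mult mult_mono)
  qed (use profileD(5)[OF profile_bump] in auto)
  have i3: "integrable N (\<lambda>y. bump (norm y) * ?e)"
    using integrable_profile[OF profile_bump] by simp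
  have "kern (Suc m) a \<le> kern (Suc m) (norm u)"
    using profileD(4)[OF profile_kern[of "Suc m"], of "norm u" a] u by simp
  also have "\<dots> = (\<integral>y. bump (norm y) * dilate (kern m) (norm (u - y)) \<partial>N)"
    by (rule kern_eq_integral[OF u(1)])
  also have "\<dots> \<le> (\<integral>y. bump (norm y) * dilate (kern m) (h y) + bump (norm y) * ?e \<partial>N)"
  proof (rule integral_mono_AE[OF i1])
    show "integrable N (\<lambda>y. bump (norm y) * dilate (kern m) (h y) + bump (norm y) * ?e)"
      by (rule Bochner_Integration.integrable_add[OF i2 i3])
    show "AE y in N. bump (norm y) * dilate (kern m) (norm (u - y))
        \<le> bump (norm y) * dilate (kern m) (h y) + bump (norm y) * ?e"
      using AE_flat_lborel_span
    proof eventually_elim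
      case (elim y)
      have "norm (u - y) \<le> h y" by (simp add: hd[OF elim] real_le_rsqrt)
      moreover have "(h y)\<^sup>2 = (norm (u - y))\<^sup>2 + d\<^sup>2" by (simp add: hd[OF elim])
      ultimately have "kern m (4 * norm (u - y)) \<le> kern m (4 * h y) + height * (16 * d\<^sup>2)"
        using kern_diff_le[of "4 * norm (u - y)" "4 * h y" m] by (simp add: power_mult_distrib algebra_simps)
      then have "dilate (kern m) (norm (u - y)) \<le> dilate (kern m) (h y) + ?e"
        using mult_left_mono[of _ _ "4 ^ card K"] by (fastforce simp: dilate_def algebra_simps)
      then show ?case
        using mult_left_mono[OF _ profileD(2)[OF profile_bump]] by (fastforce simp: distrib_left)
    qed
  qed
  also have "\<dots> = (\<integral>y. bump (norm y) * dilate (kern m) (h y) \<partial>N) + ?e"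
    by (subst Bochner_Integration.integral_add[OF i2 i3]) (simp add: integral_bump)
  finally show ?thesis .
qed


section \<open>Transport of a point to an affine plane\<close>

lemma affine_parametrization:
  fixes L :: "'a set"
  assumes L: "affine L" "aff_dim L = int (card K)"
  obtains Y where "Y \<in> borel_measurable borel"
    "\<And>y. y \<in> span K \<Longrightarrow> dist x (Y y) \<le> infdist x L + \<bar>t\<bar> * norm y"
    "\<And>z. \<exists>u\<in>span K. norm u \<le> dist x z \<and>
       (\<forall>y\<in>span K. dist (Y y) z = sqrt ((norm (u - t *\<^sub>R y))\<^sup>2 + (infdist z L)\<^sup>2))"
proof -
  have "L \<noteq> {}" using L(2) by (metis aff_dim_empty of_nat_0_le_iff not_one_le_zero neg_0_le_iff_le)
  then obtain p where p: "p \<in> L" by auto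
  define W where "W = (\<lambda>v. v - p) ` L"
  have W: "subspace W"
    unfolding W_def using affine_diffs_subspace_subtract[OF L(1) p] by simp
  have WL: "p + w \<in> L \<longleftrightarrow> w \<in> W" for w by (force simp: W_def)
  have indep: "independent K" using independent_mono[OF independent_Basis K] .
  have "int (dim W) = aff_dim L"
    using aff_dim_eq_dim_subtract[of p L] p by (simp add: hull_inc W_def)
  then have "dim (span K) = dim W"
    using L(2) dim_span_eq_card_independent[OF indep] by simp
  from isometries_subspaces[OF subspace_span W this]
  obtain f g where f: "linear f" "f ` span K = W" "\<And>v. v \<in> span K \<Longrightarrow> norm (f v) = norm v"
    and g: "g ` W = span K" "\<And>w. w \<in> W \<Longrightarrow> f (g w) = w"
    by metis
  have "\<exists>w n. w \<in> W \<and> (\<forall>v\<in>W. n \<bullet> v = 0) \<and> z = p + w + n" for z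
  proof -
    obtain w n where "w \<in> span W" "\<And>v. v \<in> span W \<Longrightarrow> orthogonal n v" "z - p = w + n"
      using orthogonal_subspace_decomp_exists[of W "z - p"] by blast
    moreover have "span W = W" using W by simp
    ultimately have "w \<in> W \<and> (\<forall>v\<in>W. n \<bullet> v = 0) \<and> z = p + w + n"
      by (auto simp: orthogonal_def algebra_simps)
    then show ?thesis by blast
  qed
  then obtain w n where wn: "\<And>z. w z \<in> W" "\<And>z v. v \<in> W \<Longrightarrow> n z \<bullet> v = 0" "\<And>z. z = p + w z + n z"
    by metis
  have pyth: "(norm (v + n'))\<^sup>2 = (norm v)\<^sup>2 + (norm n')\<^sup>2" if "n' \<bullet> v = 0" for v n' :: 'a
    using that by (simp add: power2_norm_eq_inner inner_simps inner_commute)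
  have dist2: "(dist (p + v) z)\<^sup>2 = (norm (w z - v))\<^sup>2 + (norm (n z))\<^sup>2" if "v \<in> W" for v z
  proof -
    have "dist (p + v) z = norm ((w z - v) + n z)"
      by (subst (1) wn(3)[of z]) (simp add: dist_norm norm_minus_commute algebra_simps)
    moreover have "n z \<bullet> (w z - v) = 0" using wn(1,2) that by (simp add: inner_diff_right)
    ultimately show ?thesis by (simp add: pyth)
  qed
  have inf: "infdist z L = norm (n z)" for z
  proof (rule antisym)
    have "dist (p + w z) z = norm (n z)"
      using dist2[of "w z" z] wn(1) by simp
    then show "infdist z L \<le> norm (n z)"
      using infdist_le[of "p + w z" L z] wn(1) WL by (simp add: dist_commute)
    have "norm (n z) \<le> dist z a" if "a \<in> L" for a
    proof -
      have "a - p \<in> W" using that by (auto simp: W_def)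
      then have "(norm (n z))\<^sup>2 \<le> (dist a z)\<^sup>2" using dist2[of "a - p" z] by simp
      then show ?thesis by (simp add: dist_commute)
    qed
    then show "norm (n z) \<le> infdist z L"
      using \<open>L \<noteq> {}\<close> unfolding infdist_def by (auto intro: cINF_greatest)
  qed
  \<comment> \<open>The projection of \<open>x\<close> to \<open>L\<close>, moved by
    \<open>t\<close> times an isometric copy of \<open>y\<close> in the direction space
    \<open>W\<close>.\<close>
  define Y where "Y y = p + (w x + t *\<^sub>R f y)" for y
  have fW: "f y \<in> W" if "y \<in> span K" for y using f(2) that by auto
  show thesis
  proof
    have "continuous_on UNIV f"
      using f(1) by (simp add: linear_continuous_on linear_linear)
    then show "Y \<in> borel_measurable borel"
      unfolding Y_def[abs_def] by (intro borel_measurable_continuous_onI continuous_intros) auto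
  next
    fix y assume y: "y \<in> span K"
    have "dist x (Y y) = norm (n x - t *\<^sub>R f y)"
      unfolding Y_def by (subst (1) wn(3)[of x]) (simp add: dist_norm algebra_simps)
    also have "\<dots> \<le> norm (n x) + norm (t *\<^sub>R f y)" by (rule norm_triangle_ineq4)
    finally show "dist x (Y y) \<le> infdist x L + \<bar>t\<bar> * norm y" by (simp add: inf f(3)[OF y])
  next
    fix z
    \<comment> \<open>The position of the projection of \<open>z\<close> relative to that of
      \<open>x\<close>, read in \<open>span K\<close>. Its norm is at most \<open>dist x z\<close>
      because projections contract, and the distance formula is Pythagoras' theorem.\<close>
    define u where "u = g (w z - w x)"
    have d: "w z - w x \<in> W" using wn(1) W by (simp add: subspace_diff)
    have u: "u \<in> span K" "f u = w z - w x" using g d by (auto simp: u_def)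
    have "norm u \<le> dist x z"
    proof -
      have "x - z = (w x - w z) + (n x - n z)"
        by (subst (1) wn(3)[of x], subst (1) wn(3)[of z]) simp
      moreover have "(n x - n z) \<bullet> (w x - w z) = 0"
        using wn(1,2) by (simp add: inner_simps)
      ultimately have "(dist x z)\<^sup>2 = (norm (w x - w z))\<^sup>2 + (norm (n x - n z))\<^sup>2"
        by (simp add: dist_norm pyth)
      then have "(norm (w x - w z))\<^sup>2 \<le> (dist x z)\<^sup>2"
        using zero_le_power2[of "norm (n x - n z)"] by linarith
      then have "norm (w x - w z) \<le> dist x z"
        by (rule power2_le_imp_le) simp
      then show ?thesis using f(3)[OF u(1)] u(2) by (simp add: norm_minus_commute)
    qed
    moreover have "dist (Y y) z = sqrt ((norm (u - t *\<^sub>R y))\<^sup>2 + (infdist z L)\<^sup>2)" if y: "y \<in> span K" for y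
    proof -
      have v: "w x + t *\<^sub>R f y \<in> W"
        using wn(1) fW[OF y] W by (simp add: subspace_add subspace_scale)
      have "u - t *\<^sub>R y \<in> span K" using u y by (simp add: span_diff span_scale)
      from f(3)[OF this] have "norm (w z - (w x + t *\<^sub>R f y)) = norm (u - t *\<^sub>R y)"
        using f(1) u(2) by (simp add: linear_diff linear_scale algebra_simps)
      then have "(dist (Y y) z)\<^sup>2 = (norm (u - t *\<^sub>R y))\<^sup>2 + (infdist z L)\<^sup>2"
        using dist2[OF v, of z] by (simp add: Y_def inf)
      then show ?thesis by (metis real_sqrt_unique zero_le_dist)
    qed
    ultimately show "\<exists>u\<in>span K. norm u \<le> dist x z \<and>
       (\<forall>y\<in>span K. dist (Y y) z = sqrt ((norm (u - t *\<^sub>R y))\<^sup>2 + (infdist z L)\<^sup>2))"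
      using u(1) by blast
  qed
qed

text \<open>Width 4^-j and integral 1 over \<open>span K\<close>. The factors are bumps at the
  scales j, ..., J, so that passing from \<open>j\<close> to \<open>Suc j\<close> removes exactly
  the widest one.\<close>

definition phi :: "nat \<Rightarrow> nat \<Rightarrow> real \<Rightarrow> real" where
  "phi J j s = 4 ^ (j * card K) * kern (J - j) (4 ^ j * s)"

lemma phi_nonneg: "0 \<le> phi J j s"
  using profileD(2)[OF profile_kern] by (simp add: phi_def)

lemma phi_le: "phi J j s \<le> 4 ^ (j * card K) * height"
  using profileD(3)[OF profile_kern] by (simp add: phi_def)

lemma phi_eq_0:
  assumes "s \<ge> 4/3 * (1/4) ^ j"
  shows "phi J j s = 0"
proof -
  have "4 ^ j * (4/3 * (1/4) ^ j) \<le> 4 ^ j * s" using assms by (intro mult_left_mono) auto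
  then have "4/3 \<le> 4 ^ j * s" by (simp add: power_divide)
  then show ?thesis using profileD(5)[OF profile_kern] by (simp add: phi_def)
qed

lemma measurable_phi: "phi J j \<in> borel_measurable borel"
  using measurable_compose[OF _ profileD(1)[OF profile_kern], of "\<lambda>s. 4 ^ j * s" borel "J - j"]
  unfolding phi_def[abs_def] by simp

text \<open>This is \<open>kern_Suc_le\<close> rescaled by \<open>4 ^ j\<close>. In the exponent
  \<open>j * (card K + 2)\<close>, the part \<open>card K\<close> is the normalisation of the kernel
  and the 2 belongs to the squared distance, which matches the normalisation of the
  displacement.\<close>

lemma phi_transport:
  fixes L :: "'a set"
  assumes L: "affine L" "aff_dim L = int (card K)" and j: "j < J"
  obtains Y where "Y \<in> borel_measurable borel"
    "\<And>y. y \<in> span K \<Longrightarrow> norm y \<le> 1 \<Longrightarrow> dist x (Y y) \<le> infdist x L + (1/4) ^ j"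
    "\<And>z. phi J j (dist x z) \<le> (\<integral>y. bump (norm y) * phi J (Suc j) (dist (Y y) z) \<partial>N)
       + 16 * 4 ^ card K * height * 4 ^ (j * (card K + 2)) * (infdist z L)\<^sup>2"
proof -
  obtain Y where Y: "Y \<in> borel_measurable borel"
    "\<And>y. y \<in> span K \<Longrightarrow> dist x (Y y) \<le> infdist x L + \<bar>(1/4) ^ j\<bar> * norm y"
    "\<And>z. \<exists>u\<in>span K. norm u \<le> dist x z \<and>
       (\<forall>y\<in>span K. dist (Y y) z = sqrt ((norm (u - (1/4) ^ j *\<^sub>R y))\<^sup>2 + (infdist z L)\<^sup>2))"
    using affine_parametrization[OF L, of x "(1/4) ^ j"] by metis
  obtain m where m: "J - j = Suc m" "J - Suc j = m" using j by (metis Suc_diff_Suc)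
  show thesis
  proof
    show "dist x (Y y) \<le> infdist x L + (1/4) ^ j" if "y \<in> span K" "norm y \<le> 1" for y
    proof -
      have "\<bar>(1/4) ^ j\<bar> * norm y \<le> (1/4) ^ j" using that(2) by (simp add: mult_left_le)
      then show ?thesis using Y(2)[OF that(1)] by linarith
    qed
  next
    fix z
    let ?q = "4 ^ j :: real" and ?k = "card K"
    obtain u where u: "u \<in> span K" "norm u \<le> dist x z"
      "\<And>y. y \<in> span K \<Longrightarrow> dist (Y y) z = sqrt ((norm (u - (1/4) ^ j *\<^sub>R y))\<^sup>2 + (infdist z L)\<^sup>2)"
      using Y(3)[of z] by blast
    have h: "?q * dist (Y y) z = sqrt ((norm (?q *\<^sub>R u - y))\<^sup>2 + (?q * infdist z L)\<^sup>2)"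
      if y: "y \<in> span K" for y
    proof -
      have "?q *\<^sub>R u - y = ?q *\<^sub>R (u - (1/4) ^ j *\<^sub>R y)"
        by (simp add: scaleR_diff_right power_divide)
      then have "(norm (?q *\<^sub>R u - y))\<^sup>2 + (?q * infdist z L)\<^sup>2
         = ?q\<^sup>2 * ((norm (u - (1/4) ^ j *\<^sub>R y))\<^sup>2 + (infdist z L)\<^sup>2)"
        by (simp add: power_mult_distrib distrib_left)
      then show ?thesis by (simp add: u(3)[OF y] real_sqrt_mult)
    qed
    have "kern (Suc m) (?q * dist x z)
      \<le> (\<integral>y. bump (norm y) * dilate (kern m) (?q * dist (Y y) z) \<partial>N)
        + 16 * 4 ^ ?k * height * (?q * infdist z L)\<^sup>2"
    proof (rule kern_Suc_le)
      show "?q *\<^sub>R u \<in> span K" using u(1) by (simp add: span_scale)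
      show "norm (?q *\<^sub>R u) \<le> ?q * dist x z" using u(2) by simp
      show "(\<lambda>y. ?q * dist (Y y) z) \<in> borel_measurable borel" using Y(1) by measurable
    qed (rule h)
    then have "?q ^ ?k * kern (Suc m) (?q * dist x z)
      \<le> ?q ^ ?k * ((\<integral>y. bump (norm y) * dilate (kern m) (?q * dist (Y y) z) \<partial>N)
        + 16 * 4 ^ ?k * height * (?q * infdist z L)\<^sup>2)"
      by (intro mult_left_mono) auto
    also have "\<dots> = (\<integral>y. ?q ^ ?k * (bump (norm y) * dilate (kern m) (?q * dist (Y y) z)) \<partial>N)
        + 16 * 4 ^ ?k * height * (?q ^ ?k * ?q\<^sup>2) * (infdist z L)\<^sup>2"
      by (simp add: distrib_left power_mult_distrib)
    also have "(\<lambda>y. ?q ^ ?k * (bump (norm y) * dilate (kern m) (?q * dist (Y y) z)))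
        = (\<lambda>y. bump (norm y) * phi J (Suc j) (dist (Y y) z))"
      by (simp add: fun_eq_iff phi_def dilate_def m power_add power_mult mult.assoc)
    also have "?q ^ ?k * ?q\<^sup>2 = 4 ^ (j * (?k + 2))"
      by (simp only: power_add[symmetric] power_mult[symmetric] distrib_left)
    finally show "phi J j (dist x z) \<le> (\<integral>y. bump (norm y) * phi J (Suc j) (dist (Y y) z) \<partial>N)
       + 16 * 4 ^ ?k * height * 4 ^ (j * (?k + 2)) * (infdist z L)\<^sup>2"
      by (simp add: phi_def m power_mult)
  qed (rule Y(1))
qed


section \<open>Induction over scales\<close>

text \<open>The cut-off equals 4 at scale 2, so all centres of radius at most 4 are counted there. A
  centre that is counted at scale \<open>j\<close> but not at \<open>Suc j\<close> has radius above
  16 * 4^-j, which is far more than the width of the kernel.\<close>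

definition smoothed_density :: "('a \<Rightarrow> real) \<Rightarrow> 'a set \<Rightarrow> nat \<Rightarrow> nat \<Rightarrow> 'a \<Rightarrow> real" where
  "smoothed_density r G J j x =
     (\<Sum>z\<in>{z\<in>G. r z \<le> 64 * (1/4) ^ j}. r z ^ card K * phi J j (dist x z))"

text \<open>A step of the induction that bounds the smoothed density, from scale \<open>(1/4) ^ Suc j\<close> to scale
  \<open>(1/4) ^ j\<close>. The bound \<open>A - C * (\<Sum>i<j. a i g)\<close> is chosen so that the error of the transport along
  the optimal plane of \<open>g\<close>, which is at most \<open>C * a j g\<close>, is paid for by the gain in the sum. The first
  alternative covers the places where the mass is small or where a single ball dominates.\<close>

lemma smoothed_density_step:
  fixes G :: "'a set" and a :: "nat \<Rightarrow> 'a \<Rightarrow> real"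
  defines "k \<equiv> card K"
  defines "C \<equiv> 16 * 4 ^ k * height"
  assumes fin: "finite G" and r: "\<And>x. x \<in> G \<Longrightarrow> 0 < r x"
    and sep: "\<And>x y. x \<in> G \<Longrightarrow> y \<in> G \<Longrightarrow> x \<noteq> y \<Longrightarrow> r x \<le> dist x y"
    and a: "\<And>i g. 0 \<le> a i g" "\<And>g. g \<in> G \<Longrightarrow> (\<Sum>i<J. a i g) \<le> s"
    and \<Lambda>: "s < \<Lambda>" "0 < \<Lambda>"
    and A0: "height * 64 ^ k \<le> A0" "height * \<Lambda> \<le> A0" and A: "A = A0 + C * s"
    and j: "j < J"
    and plane: "\<And>g. g \<in> G \<Longrightarrow>
        \<Lambda> * ((1/4) ^ j) ^ k \<le> (\<Sum>z\<in>{z\<in>G. dist g z < 8 * (1/4) ^ j}. r z ^ k) \<Longrightarrow>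
        \<exists>L. affine L \<and> aff_dim L = int k \<and>
          (\<Sum>z\<in>{z\<in>G. dist g z < 8 * (1/4) ^ j}. r z ^ k * (infdist z L)\<^sup>2) \<le> a j g * ((1/4) ^ j) ^ (k + 2)"
    and IH: "\<And>x. smoothed_density r G J (Suc j) x \<le> A0 \<or>
        (\<exists>g\<in>G. dist x g \<le> 5 * (1/4) ^ Suc j \<and> smoothed_density r G J (Suc j) x \<le> A - C * (\<Sum>i<Suc j. a i g))"
  shows "smoothed_density r G J j x \<le> A0 \<or>
        (\<exists>g\<in>G. dist x g \<le> 5 * (1/4) ^ j \<and> smoothed_density r G J j x \<le> A - C * (\<Sum>i<j. a i g))"
proof -
  define t :: real where "t = (1/4) ^ j"
  have "4 ^ (j * l) * t ^ l = 1" for l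
    by (simp add: t_def power_divide power_mult)
  then have t: "t > 0" "4 ^ (j * k) * t ^ k = 1" "4 ^ (j * (k + 2)) * t ^ (k + 2) = 1" "(1/4) ^ Suc j = t / 4"
    by (simp_all add: t_def del: add_2_eq_Suc')
  have C: "C \<ge> 0" using height_pos by (simp add: C_def)
  define Z where "Z = {z\<in>G. r z \<le> 64 * t \<and> dist x z < 4/3 * t}"
  have Z: "finite Z" "Z \<subseteq> G" using fin by (auto simp: Z_def)
  have dens: "smoothed_density r G J j x = (\<Sum>z\<in>Z. r z ^ k * phi J j (dist x z))"
    unfolding smoothed_density_def k_def
    by (rule sum.mono_neutral_cong_right)
       (use fin phi_eq_0[of j _ J] in \<open>auto simp: Z_def t_def[symmetric] not_less\<close>)
  have rk: "0 \<le> r z ^ k" if "z \<in> G" for z using r[OF that] by simp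
  show ?thesis
  \<comment> \<open>The bound \<open>16 * t\<close> is the cut-off of the next finer scale, so such
    a \<open>z\<close> enters at this scale. It is then alone: points of \<open>Z\<close> are less
    than 8/3 * t apart, whereas \<open>sep\<close> demands more than \<open>16 * t\<close>.\<close>
  proof (cases "\<exists>z\<in>Z. 16 * t < r z")
    case True
    then obtain z where z: "z \<in> Z" "16 * t < r z" by blast
    have "z' = z" if z': "z' \<in> Z" for z'
    proof (rule ccontr)
      assume "z' \<noteq> z"
      then have "16 * t < dist z z'" using sep[of z z'] z z' Z by force
      moreover have "dist z z' \<le> dist x z + dist x z'" by (rule dist_triangle3)
      ultimately show False using z z' t(1) by (simp add: Z_def)
    qed
    then have "Z = {z}" using z by blast
    then have "smoothed_density r G J j x = r z ^ k * phi J j (dist x z)" by (simp add: dens)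
    also have "\<dots> \<le> (64 * t) ^ k * (4 ^ (j * k) * height)"
      using z r[of z] Z phi_le[of J j "dist x z"] phi_nonneg height_pos
      by (intro mult_mono power_mono) (auto simp: Z_def k_def)
    also have "\<dots> = height * 64 ^ k"
      using t(2) by (simp add: power_mult_distrib mult.commute mult.left_commute)
    finally show ?thesis using A0 by simp
  next
    case small: False
    show ?thesis
    \<comment> \<open>Little mass near \<open>x\<close> is covered by the sup bound
      \<open>phi_le\<close>; otherwise the premise of \<open>plane\<close> holds at every centre
      close enough to \<open>x\<close>.\<close>
    proof (cases "(\<Sum>z\<in>Z. r z ^ k) < \<Lambda> * t ^ k")
      case True
      have "smoothed_density r G J j x \<le> (\<Sum>z\<in>Z. r z ^ k * (4 ^ (j * k) * height))"
        unfolding dens using phi_le rk Z by (intro sum_mono mult_left_mono) (auto simp: k_def)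
      also have "\<dots> = (\<Sum>z\<in>Z. r z ^ k) * (4 ^ (j * k) * height)" by (simp add: sum_distrib_right)
      also have "\<dots> \<le> (\<Lambda> * t ^ k) * (4 ^ (j * k) * height)"
        using True height_pos by (intro mult_right_mono) auto
      also have "\<dots> = height * \<Lambda>"
        using t(2) by (simp add: mult.commute mult.left_commute)
      finally show ?thesis using A0 by simp
    next
      case False
      then have dense: "\<Lambda> * t ^ k \<le> (\<Sum>z\<in>Z. r z ^ k)" by simp
      have "0 < \<Lambda> * t ^ k" using \<Lambda> t(1) by simp
      then have "Z \<noteq> {}" using dense by auto
      \<comment> \<open>The witness \<open>g\<close> minimises the accumulated displacement, current
        scale included, among the centres within \<open>5 * t\<close>. Bounds obtained with any
        other such witness then imply the bound with \<open>g\<close>.\<close>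
      define S where "S g = (\<Sum>i<Suc j. a i g)" for g
      define H where "H = {g\<in>G. dist x g \<le> 5 * t}"
      have ZH: "Z \<subseteq> H" using t(1) by (auto simp: Z_def H_def)
      have "finite H" "H \<noteq> {}" using fin ZH \<open>Z \<noteq> {}\<close> by (auto simp: H_def)
      then have "Min (S ` H) \<in> S ` H" by simp
      then obtain g where "g \<in> H" "S g = Min (S ` H)" by (metis imageE)
      then have g: "g \<in> H" "\<And>h. h \<in> H \<Longrightarrow> S g \<le> S h"
        using \<open>finite H\<close> by simp_all
      then have gG: "g \<in> G" "dist x g \<le> 5 * t" by (auto simp: H_def)
      \<comment> \<open>Radius 8 suffices to contain \<open>Z\<close>, since 5 + 4/3 < 8.\<close>
      define B where "B = {z\<in>G. dist g z < 8 * t}"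
      have B: "finite B" "B \<subseteq> G" using fin by (auto simp: B_def)
      have ZB: "Z \<subseteq> B"
      proof
        fix z assume z: "z \<in> Z"
        have "dist g z \<le> dist x g + dist x z" by (rule dist_triangle3)
        then show "z \<in> B" using z gG t(1) by (auto simp: B_def Z_def)
      qed
      have "(\<Sum>z\<in>Z. r z ^ k) \<le> (\<Sum>z\<in>B. r z ^ k)"
        using B ZB rk by (intro sum_mono2) auto
      then obtain L where L: "affine L" "aff_dim L = int k"
        "(\<Sum>z\<in>B. r z ^ k * (infdist z L)\<^sup>2) \<le> a j g * t ^ (k + 2)"
        using plane[OF gG(1)] dense unfolding B_def t_def by fastforce
      have "(\<Sum>z\<in>Z. r z ^ k * (infdist z L)\<^sup>2) \<le> (\<Sum>z\<in>B. r z ^ k * (infdist z L)\<^sup>2)"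
        using B ZB rk by (intro sum_mono2) auto
      then have LZ: "(\<Sum>z\<in>Z. r z ^ k * (infdist z L)\<^sup>2) \<le> a j g * t ^ (k + 2)"
        using L(3) by simp
      have "a j g \<le> (\<Sum>i<J. a i g)"
        using j a(1) by (intro member_le_sum) auto
      then have ajs: "a j g < \<Lambda>" using a(2)[OF gG(1)] \<Lambda> by simp
      have Sle: "S g \<le> s"
      proof -
        have "S g \<le> (\<Sum>i<J. a i g)"
          unfolding S_def using j a(1) by (intro sum_mono2) auto
        then show ?thesis using a(2)[OF gG(1)] by simp
      qed
      \<comment> \<open>If all of \<open>Z\<close> were further than \<open>t\<close> from
        \<open>L\<close>, its mass of at least \<open>\<Lambda> * t ^ k\<close> would force
        \<open>a j g \<ge> \<Lambda>\<close>, against \<open>s < \<Lambda>\<close>. So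
        \<open>L\<close> passes near \<open>x\<close>, and transport to \<open>L\<close> moves
        \<open>x\<close> by a bounded multiple of \<open>t\<close>.\<close>
      have "\<exists>z\<in>Z. infdist z L \<le> t"
      proof (rule ccontr)
        assume "\<not> ?thesis"
        then have far: "t < infdist z L" if "z \<in> Z" for z using that by force
        have "a j g * t ^ (k + 2) < \<Lambda> * t ^ (k + 2)"
          using ajs t(1) by (intro mult_strict_right_mono) auto
        also have "\<dots> = (\<Lambda> * t ^ k) * t\<^sup>2"
          by (simp add: power_add power2_eq_square)
        also have "\<dots> \<le> (\<Sum>z\<in>Z. r z ^ k) * t\<^sup>2"
          using dense by (intro mult_right_mono) auto
        also have "\<dots> = (\<Sum>z\<in>Z. r z ^ k * t\<^sup>2)" by (simp add: sum_distrib_right)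
        also have "\<dots> \<le> (\<Sum>z\<in>Z. r z ^ k * (infdist z L)\<^sup>2)"
        proof (intro sum_mono mult_left_mono power_mono)
          show "t \<le> infdist z L" if "z \<in> Z" for z using far[OF that] by simp
          show "0 \<le> r z ^ k" if "z \<in> Z" for z using rk[of z] that Z(2) by blast
        qed (use t(1) in simp)
        finally show False using LZ by simp
      qed
      then obtain z0 where z0: "z0 \<in> Z" "infdist z0 L \<le> t" by blast
      have "infdist x L \<le> infdist z0 L + dist x z0" by (rule infdist_triangle)
      then have xL: "infdist x L \<le> 7/3 * t" using z0 by (simp add: Z_def)
      obtain Y where Y: "Y \<in> borel_measurable borel"
        "\<And>y. y \<in> span K \<Longrightarrow> norm y \<le> 1 \<Longrightarrow> dist x (Y y) \<le> infdist x L + t"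
        "\<And>z. phi J j (dist x z) \<le> (\<integral>y. bump (norm y) * phi J (Suc j) (dist (Y y) z) \<partial>N)
          + C * 4 ^ (j * (k + 2)) * (infdist z L)\<^sup>2"
        using phi_transport[OF L(1) L(2)[unfolded k_def] j, of x, folded t_def, folded k_def, folded C_def]
        by blast
      \<comment> \<open>If the finer scale gives only the first alternative, then
        \<open>A0 \<le> A - C * S g\<close> because \<open>S g \<le> s\<close>; this is why
        \<open>A\<close> exceeds \<open>A0\<close> by \<open>C * s\<close>.\<close>
      have Ybound: "smoothed_density r G J (Suc j) (Y y) \<le> A - C * S g" if y: "y \<in> span K" "norm y \<le> 1" for y
        using IH[of "Y y"]
      proof (elim disjE bexE conjE)
        assume "smoothed_density r G J (Suc j) (Y y) \<le> A0"
        moreover have "C * S g \<le> C * s" using C Sle by (rule mult_left_mono[rotated])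
        ultimately show ?thesis using A by simp
      next
        fix h assume h: "h \<in> G" "dist (Y y) h \<le> 5 * (1/4) ^ Suc j"
          "smoothed_density r G J (Suc j) (Y y) \<le> A - C * (\<Sum>i<Suc j. a i h)"
        have "dist x h \<le> dist x (Y y) + dist (Y y) h" by (rule dist_triangle)
        \<comment> \<open>The constant 5 closes the induction: 7/3 + 1 for the move to
          \<open>Y y\<close> and 5/4 for the witness at the finer scale add up to 55/12.\<close>
        also have "\<dots> \<le> 5 * t" using Y(2)[OF y] h(2) xL t(1) unfolding t(4) by simp
        finally have "h \<in> H" using h(1) by (simp add: H_def)
        then have "C * S g \<le> C * S h" using g(2) C by (intro mult_left_mono) auto
        then show ?thesis using h(3) by (simp add: S_def)
      qed
      \<comment> \<open>No centre of \<open>Z\<close> is lost in passing to the finer scale, as none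
        has radius above its cut-off.\<close>
      have near: "(\<Sum>z\<in>Z. r z ^ k * phi J (Suc j) (dist y z)) \<le> smoothed_density r G J (Suc j) y" for y
        unfolding smoothed_density_def k_def
      proof (rule sum_mono2)
        show "Z \<subseteq> {z\<in>G. r z \<le> 64 * (1/4) ^ Suc j}"
          using small unfolding t(4) by (auto simp: Z_def)
      qed (use fin rk phi_nonneg in \<open>auto simp: k_def\<close>)
      have int: "integrable N (\<lambda>y. bump (norm y) * phi J (Suc j) (dist (Y y) z))" for z
      proof (rule integrable_N[where B="height * (4 ^ (Suc j * card K) * height)" and r=1])
        show "(\<lambda>y. bump (norm y) * phi J (Suc j) (dist (Y y) z)) \<in> borel_measurable borel"
          using measurable_profile_norm[OF profile_bump, of "\<lambda>y::'a. y" borel]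
            measurable_compose[OF borel_measurable_dist[OF Y(1) measurable_const] measurable_phi[of J "Suc j"], of z]
          by (intro borel_measurable_times) auto
        show "\<bar>bump (norm y) * phi J (Suc j) (dist (Y y) z)\<bar> \<le> height * (4 ^ (Suc j * card K) * height)" for y
        proof -
          have "bump (norm y) * phi J (Suc j) (dist (Y y) z) \<le> height * (4 ^ (Suc j * card K) * height)"
            using height_pos by (intro mult_mono profileD(3)[OF profile_bump] phi_le phi_nonneg) simp
          moreover have "0 \<le> bump (norm y) * phi J (Suc j) (dist (Y y) z)"
            by (intro mult_nonneg_nonneg profileD(2)[OF profile_bump] phi_nonneg)
          ultimately show ?thesis by (metis abs_of_nonneg)
        qed
      qed (use profileD(5)[OF profile_bump] in auto)
      have "smoothed_density r G J j x
         \<le> (\<Sum>z\<in>Z. r z ^ k * (\<integral>y. bump (norm y) * phi J (Suc j) (dist (Y y) z) \<partial>N)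
              + C * 4 ^ (j * (k + 2)) * (r z ^ k * (infdist z L)\<^sup>2))"
        unfolding dens
      proof (rule sum_mono)
        fix z assume "z \<in> Z"
        then have "r z ^ k * phi J j (dist x z) \<le> r z ^ k *
          ((\<integral>y. bump (norm y) * phi J (Suc j) (dist (Y y) z) \<partial>N) + C * 4 ^ (j * (k + 2)) * (infdist z L)\<^sup>2)"
          using Y(3) rk Z by (intro mult_left_mono) auto
        then show "r z ^ k * phi J j (dist x z) \<le> r z ^ k * (\<integral>y. bump (norm y) * phi J (Suc j) (dist (Y y) z) \<partial>N)
              + C * 4 ^ (j * (k + 2)) * (r z ^ k * (infdist z L)\<^sup>2)"
          by (simp add: algebra_simps)
      qed
      also have "\<dots> = (\<integral>y. (\<Sum>z\<in>Z. r z ^ k * (bump (norm y) * phi J (Suc j) (dist (Y y) z))) \<partial>N)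
          + C * 4 ^ (j * (k + 2)) * (\<Sum>z\<in>Z. r z ^ k * (infdist z L)\<^sup>2)"
        using int by (simp add: sum.distrib sum_distrib_left)
      also have "\<dots> \<le> (\<integral>y. bump (norm y) * (A - C * S g) \<partial>N)
          + C * 4 ^ (j * (k + 2)) * (a j g * t ^ (k + 2))"
      proof (rule add_mono)
        show "(\<integral>y. (\<Sum>z\<in>Z. r z ^ k * (bump (norm y) * phi J (Suc j) (dist (Y y) z))) \<partial>N)
          \<le> (\<integral>y. bump (norm y) * (A - C * S g) \<partial>N)"
        proof (rule integral_mono_AE)
          show "integrable N (\<lambda>y. \<Sum>z\<in>Z. r z ^ k * (bump (norm y) * phi J (Suc j) (dist (Y y) z)))"
            using int by simp
          show "integrable N (\<lambda>y. bump (norm y) * (A - C * S g))"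
            using integrable_profile[OF profile_bump] by simp
          show "AE y in N. (\<Sum>z\<in>Z. r z ^ k * (bump (norm y) * phi J (Suc j) (dist (Y y) z)))
             \<le> bump (norm y) * (A - C * S g)"
            using AE_flat_lborel_span
          proof eventually_elim
            case (elim y)
            have eq: "(\<Sum>z\<in>Z. r z ^ k * (bump (norm y) * phi J (Suc j) (dist (Y y) z)))
              = bump (norm y) * (\<Sum>z\<in>Z. r z ^ k * phi J (Suc j) (dist (Y y) z))"
              by (simp add: sum_distrib_left mult.left_commute)
            show ?case
            proof (cases "norm y \<le> 1")
              case True
              then show ?thesis
                unfolding eq using near[of "Y y"] Ybound[OF elim True] profileD(2)[OF profile_bump]
                by (intro mult_left_mono) auto
            next
              case False
              then have "bump (norm y) = 0" using profileD(5)[OF profile_bump] by simp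
              then show ?thesis by simp
            qed
          qed
        qed
        show "C * 4 ^ (j * (k + 2)) * (\<Sum>z\<in>Z. r z ^ k * (infdist z L)\<^sup>2)
            \<le> C * 4 ^ (j * (k + 2)) * (a j g * t ^ (k + 2))"
          using LZ C by (intro mult_left_mono) auto
      qed
      also have "\<dots> = A - C * S g + C * a j g * (4 ^ (j * (k + 2)) * t ^ (k + 2))"
        by (simp add: integral_bump)
      \<comment> \<open>The transport error \<open>C * a j g\<close> cancels the last term of
        \<open>C * S g\<close>.\<close>
      also have "\<dots> = A - C * (\<Sum>i<j. a i g)"
        unfolding t(3) by (simp add: S_def algebra_simps)
      finally show ?thesis using gG unfolding t_def by blast
    qed
  qed
qed

text \<open>The induction runs down from \<open>J\<close>, where no centre is counted yet, to 2,
  where all are. There \<open>kern_lower\<close> is available within distance (1/3)/16 = 1/48 of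
  \<open>x\<close>; the common factor \<open>height\<close> cancels, and 9/5 is rounded up to
  2.\<close>

lemma local_mass_bound:
  fixes G :: "'a set" and a :: "nat \<Rightarrow> 'a \<Rightarrow> real"
  defines "k \<equiv> card K"
  assumes fin: "finite G" and r: "\<And>x. x \<in> G \<Longrightarrow> 0 < r x" "\<And>x. x \<in> G \<Longrightarrow> r x \<le> 4"
    and sep: "\<And>x y. x \<in> G \<Longrightarrow> y \<in> G \<Longrightarrow> x \<noteq> y \<Longrightarrow> r x \<le> dist x y"
    and a: "\<And>i g. 0 \<le> a i g" "\<And>g. g \<in> G \<Longrightarrow> (\<Sum>i<J. a i g) \<le> s"
    and \<Lambda>: "s < \<Lambda>" "0 < \<Lambda>" and J: "2 \<le> J" "\<And>x. x \<in> G \<Longrightarrow> 64 * (1/4) ^ J < r x"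
    and plane: "\<And>g j. g \<in> G \<Longrightarrow> 2 \<le> j \<Longrightarrow> j < J \<Longrightarrow>
        \<Lambda> * ((1/4) ^ j) ^ k \<le> (\<Sum>z\<in>{z\<in>G. dist g z < 8 * (1/4) ^ j}. r z ^ k) \<Longrightarrow>
        \<exists>L. affine L \<and> aff_dim L = int k \<and>
          (\<Sum>z\<in>{z\<in>G. dist g z < 8 * (1/4) ^ j}. r z ^ k * (infdist z L)\<^sup>2) \<le> a j g * ((1/4) ^ j) ^ (k + 2)"
    and s: "0 \<le> s"
  shows "(\<Sum>z\<in>G \<inter> cball x (1/48). r z ^ k) \<le> 2 * (64 ^ k + \<Lambda> + 16 * 4 ^ k * s)"
proof -
  define A0 where "A0 = height * (64 ^ k + \<Lambda>)"
  define C where "C = 16 * 4 ^ k * height"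
  have C: "C \<ge> 0" using height_pos by (simp add: C_def)
  let ?P = "\<lambda>j. \<forall>x. smoothed_density r G J j x \<le> A0 \<or>
        (\<exists>g\<in>G. dist x g \<le> 5 * (1/4) ^ j \<and> smoothed_density r G J j x \<le> A0 + C * s - C * (\<Sum>i<j. a i g))"
  have A0: "height * 64 ^ k \<le> A0" "height * \<Lambda> \<le> A0" "0 \<le> A0"
    using height_pos \<Lambda> by (auto simp: A0_def algebra_simps)
  have "?P 2"
    using J(1)
  proof (induction rule: inc_induct)
    case base
    have e: "{z \<in> G. r z \<le> 64 * (1/4) ^ J} = {}" using J(2) by force
    have "smoothed_density r G J J x = 0" for x by (simp only: smoothed_density_def e sum.empty)
    then show ?case using A0 by simp
  next
    case (step j)
    show ?case
    proof
      fix x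
      show "smoothed_density r G J j x \<le> A0 \<or>
        (\<exists>g\<in>G. dist x g \<le> 5 * (1/4) ^ j \<and> smoothed_density r G J j x \<le> A0 + C * s - C * (\<Sum>i<j. a i g))"
        unfolding C_def k_def
      proof (rule smoothed_density_step[where \<Lambda>=\<Lambda>])
        show "\<And>x. smoothed_density r G J (Suc j) x \<le> A0 \<or>
          (\<exists>g\<in>G. dist x g \<le> 5 * (1/4) ^ Suc j \<and> smoothed_density r G J (Suc j) x
            \<le> A0 + 16 * 4 ^ card K * height * s - 16 * 4 ^ card K * height * (\<Sum>i<Suc j. a i g))"
          using step.IH unfolding C_def k_def by blast
      qed (fact fin r(1) sep a \<Lambda> A0[unfolded k_def] refl step.hyps
             plane[OF _ step.hyps, unfolded k_def])+
    qed
  qed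
  moreover have "0 \<le> C * (\<Sum>i<2. a i g)" for g
    using C a(1) by (simp add: sum_nonneg)
  moreover have "0 \<le> C * s" using C s by simp
  ultimately have "smoothed_density r G J 2 x \<le> A0 + C * s" by (smt (verit))
  moreover have "5/9 * height * (\<Sum>z\<in>G \<inter> cball x (1/48). r z ^ k) \<le> smoothed_density r G J 2 x"
  proof -
    have "5/9 * height * (\<Sum>z\<in>G \<inter> cball x (1/48). r z ^ k) = (\<Sum>z\<in>G \<inter> cball x (1/48). r z ^ k * (5/9 * height))"
      by (simp add: sum_distrib_left mult.commute)
    also have "\<dots> \<le> (\<Sum>z\<in>G \<inter> cball x (1/48). r z ^ k * phi J 2 (dist x z))"
    proof (intro sum_mono mult_left_mono)
      fix z assume z: "z \<in> G \<inter> cball x (1/48)"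
      have "5/9 * height \<le> kern (J - 2) (4\<^sup>2 * dist x z)"
        using z by (intro kern_lower) auto
      also have "\<dots> \<le> phi J 2 (dist x z)"
        unfolding phi_def
        using mult_right_mono[OF one_le_power[of "4::real" "2 * card K"] profileD(2)[OF profile_kern[of "J - 2"], of "4\<^sup>2 * dist x z"]]
        by simp
      finally show "5/9 * height \<le> phi J 2 (dist x z)" .
      show "0 \<le> r z ^ k" using r(1)[of z] z by simp
    qed
    also have "\<dots> \<le> smoothed_density r G J 2 x"
      unfolding smoothed_density_def k_def
    proof (rule sum_mono2)
      show "finite {z \<in> G. r z \<le> 64 * (1/4)\<^sup>2}" using fin by simp
      show "G \<inter> cball x (1/48) \<subseteq> {z \<in> G. r z \<le> 64 * (1/4)\<^sup>2}"
        using r(2) by (auto simp: power2_eq_square)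
      show "0 \<le> r z ^ card K * phi J 2 (dist x z)" if "z \<in> {z \<in> G. r z \<le> 64 * (1/4)\<^sup>2} - G \<inter> cball x (1/48)" for z
        using that r(1)[of z] phi_nonneg by simp
    qed
    finally show ?thesis .
  qed
  ultimately have "height * (5/9 * (\<Sum>z\<in>G \<inter> cball x (1/48). r z ^ k)) \<le> height * (64 ^ k + \<Lambda> + 16 * 4 ^ k * s)"
    by (simp add: A0_def C_def algebra_simps)
  then have "5/9 * (\<Sum>z\<in>G \<inter> cball x (1/48). r z ^ k) \<le> 64 ^ k + \<Lambda> + 16 * 4 ^ k * s"
    using height_pos by simp
  moreover have "0 \<le> (\<Sum>z\<in>G \<inter> cball x (1/48). r z ^ k)"
    using r(1) by (intro sum_nonneg) (auto intro: less_imp_le)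
  ultimately show ?thesis by simp
qed

end

section \<open>Displacement and the mass bound\<close>

text \<open>The function equal to \<open>f\<close> on the finite set \<open>F\<close> and to 0
  elsewhere is measurable and lies below \<open>f\<close>. Hence the bound applies to the
  displacement without a discussion of its measurability.\<close>

lemma nn_integral_ball_measure_ge:
  fixes S :: "(real ^ 'n) set"
  assumes F: "finite F" "F \<subseteq> S"
  shows "(\<Sum>x\<in>F. ennreal (unit_ball_vol (real k) * r x ^ k) * f x) \<le> (\<integral>\<^sup>+y. f y \<partial>ball_measure k S r)"
proof -
  have single: "emeasure (ball_measure k S r) {x} = ennreal (unit_ball_vol (real k) * r x ^ k)" if "x \<in> S" for x
  proof -
    have "(\<integral>\<^sup>+y. ennreal (unit_ball_vol (real k) * r y ^ k) * indicator {x} y \<partial>count_space S)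
        = (\<Sum>y\<in>{x}. ennreal (unit_ball_vol (real k) * r y ^ k) * indicator {x} y)"
      by (rule nn_integral_count_space') (use that in auto)
    then show ?thesis by (subst emeasure_ball_measure) auto
  qed
  have "(\<Sum>x\<in>F. ennreal (unit_ball_vol (real k) * r x ^ k) * f x)
      = (\<Sum>x\<in>F. f x * emeasure (ball_measure k S r) {x})"
    using F single by (intro sum.cong) (auto simp: mult.commute)
  also have "\<dots> = (\<Sum>x\<in>F. \<integral>\<^sup>+y. f x * indicator {x} y \<partial>ball_measure k S r)"
    by (simp add: nn_integral_cmult_indicator)
  also have "\<dots> = (\<integral>\<^sup>+y. (\<Sum>x\<in>F. f x * indicator {x} y) \<partial>ball_measure k S r)"
    by (intro nn_integral_sum[symmetric] borel_measurable_times_ennreal borel_measurable_indicator) auto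
  also have "\<dots> \<le> (\<integral>\<^sup>+y. f y \<partial>ball_measure k S r)"
  proof (rule nn_integral_mono)
    fix y
    have "(\<Sum>x\<in>F. f x * indicator {x} y) = (\<Sum>x\<in>F. if y = x then f x else 0)"
      by (intro sum.cong) (auto simp: indicator_def)
    also have "\<dots> = (if y \<in> F then f y else 0)"
      using F(1) by simp
    finally show "(\<Sum>x\<in>F. f x * indicator {x} y) \<le> f y" by simp
  qed
  finally show ?thesis .
qed

text \<open>All radii between \<open>t\<close> and \<open>2 * t\<close> are treated at once: the
  integral is restricted to the ball of radius \<open>t\<close>, and the normalisation and the mass
  threshold are taken at \<open>2 * t\<close>. The threshold puts the displacement into the first
  branch of its definition.\<close>

lemma displacement_ge:
  fixes S :: "(real ^ 'n) set"
  assumes F: "finite F" "F \<subseteq> S" and r: "\<And>x. x \<in> F \<Longrightarrow> 0 \<le> r x"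
    and s: "0 < t" "t \<le> s" "s \<le> 2 * t"
    and dense: "eps CARD('n) * (2 * t) ^ k \<le> unit_ball_vol (real k) * (\<Sum>z\<in>{z\<in>F. dist x z < t}. r z ^ k)"
    and c: "\<And>L. affine L \<Longrightarrow> aff_dim L = int k \<Longrightarrow> c \<le> (\<Sum>z\<in>{z\<in>F. dist x z < t}. r z ^ k * (infdist z L)\<^sup>2)"
  shows "ennreal (unit_ball_vol (real k) * c / (2 * t) ^ (k + 2)) \<le> displacement k (ball_measure k S r) x s"
proof -
  define \<omega> where "\<omega> = unit_ball_vol (real k)"
  define B where "B = {z\<in>F. dist x z < t}"
  have \<omega>: "0 < \<omega>" unfolding \<omega>_def by (rule unit_ball_vol_pos) simp
  have B: "finite B" "B \<subseteq> S" "\<And>z. z \<in> B \<Longrightarrow> 0 \<le> r z" "\<And>z. z \<in> B \<Longrightarrow> z \<in> ball x s"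
    using F r s by (auto simp: B_def)
  have ge: "ennreal (\<omega> * (\<Sum>z\<in>B. r z ^ k * w z)) \<le> (\<integral>\<^sup>+y\<in>ball x s. ennreal (w y) \<partial>ball_measure k S r)"
    if w: "\<And>z. 0 \<le> w z" for w
  proof -
    have "ennreal (\<omega> * (\<Sum>z\<in>B. r z ^ k * w z)) = (\<Sum>z\<in>B. ennreal (\<omega> * r z ^ k * w z))"
      using B(3) w \<omega> by (subst sum_ennreal) (auto simp: sum_distrib_left mult.assoc)
    also have "\<dots> = (\<Sum>z\<in>B. ennreal (\<omega> * r z ^ k) * (ennreal (w z) * indicator (ball x s) z))"
      using B(3,4) w \<omega> by (intro sum.cong) (auto simp: ennreal_mult)
    also have "\<dots> \<le> (\<integral>\<^sup>+y\<in>ball x s. ennreal (w y) \<partial>ball_measure k S r)"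
      unfolding \<omega>_def by (rule nn_integral_ball_measure_ge[OF B(1,2)])
    finally show ?thesis .
  qed
  have eps: "0 \<le> eps CARD('n)" by (simp add: eps_def)
  have "ennreal (eps CARD('n) * s ^ k) \<le> ennreal (eps CARD('n) * (2 * t) ^ k)"
    using s eps by (intro ennreal_leI mult_left_mono power_mono) auto
  also have "\<dots> \<le> ennreal (\<omega> * (\<Sum>z\<in>B. r z ^ k * 1))"
    using dense by (intro ennreal_leI) (simp add: \<omega>_def B_def)
  also have "\<dots> \<le> (\<integral>\<^sup>+y\<in>ball x s. ennreal 1 \<partial>ball_measure k S r)"
    by (rule ge) simp
  also have "\<dots> = emeasure (ball_measure k S r) (ball x s)" by simp
  finally have d: "ennreal (eps CARD('n) * s ^ k) \<le> emeasure (ball_measure k S r) (ball x s)" .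
  have "ennreal (\<omega> * c / (2 * t) ^ (k + 2)) \<le> ennreal (s powi (- int (k + 2))) *
             (\<integral>\<^sup>+y\<in>ball x s. ennreal ((infdist y L)\<^sup>2) \<partial>ball_measure k S r)"
    if L: "affine L" "aff_dim L = int k" for L
  proof -
    define q where "q = (\<Sum>z\<in>B. r z ^ k * (infdist z L)\<^sup>2)"
    have q: "c \<le> q" "0 \<le> q"
      using c[OF L] B(3) by (auto simp: q_def B_def intro!: sum_nonneg)
    have "\<omega> * c / (2 * t) ^ (k + 2) \<le> \<omega> * q / (2 * t) ^ (k + 2)"
      using q(1) \<omega> s by (intro divide_right_mono mult_left_mono) auto
    also have "\<dots> \<le> \<omega> * q / s ^ (k + 2)"
      using q(2) \<omega> s by (intro divide_left_mono power_mono mult_nonneg_nonneg mult_pos_pos zero_less_power) auto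
    also have "\<dots> = s powi (- int (k + 2)) * (\<omega> * q)"
      by (simp only: power_int_minus power_int_of_nat divide_inverse mult.commute)
    finally have "ennreal (\<omega> * c / (2 * t) ^ (k + 2)) \<le> ennreal (s powi (- int (k + 2)) * (\<omega> * q))"
      by (rule ennreal_leI)
    also have "\<dots> = ennreal (s powi (- int (k + 2))) * ennreal (\<omega> * q)"
      using s q(2) \<omega> by (intro ennreal_mult) auto
    also have "\<dots> \<le> ennreal (s powi (- int (k + 2))) *
             (\<integral>\<^sup>+y\<in>ball x s. ennreal ((infdist y L)\<^sup>2) \<partial>ball_measure k S r)"
      unfolding q_def by (intro mult_left_mono ge) auto
    finally show ?thesis .
  qed
  then show ?thesis
    unfolding displacement_def \<omega>_def[symmetric] using d by (auto intro!: INF_greatest)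
qed

text \<open>The windows from 8 * 4^-j to 16 * 4^-j are disjoint and lie below 2 once j is at least
  2. On a window of length 8 * 4^-j the weight 1/s exceeds 1/(16 * 4^-j), so it contributes at least
  half of \<open>b j\<close>.\<close>

lemma dyadic_integral_ge:
  fixes h :: "real \<Rightarrow> ennreal" and b :: "nat \<Rightarrow> real"
  assumes b: "\<And>j. 0 \<le> b j"
    and h: "\<And>j s. 2 \<le> j \<Longrightarrow> j < J \<Longrightarrow> 8 * (1/4) ^ j < s \<Longrightarrow> s < 16 * (1/4) ^ j \<Longrightarrow> ennreal (b j) \<le> h s"
  shows "ennreal ((\<Sum>j\<in>{2..<J}. b j) / 2) \<le> (\<integral>\<^sup>+s\<in>{0<..<2}. h s * ennreal (1 / s) \<partial>lborel)"
proof -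
  define A where "A j = {8 * (1/4) ^ j<..<16 * (1/4) ^ j :: real}" for j :: nat
  have disj: "i = j" if "s \<in> A i" "s \<in> A j" for s i j
  proof -
    have *: False if "i < j" "s \<in> A i" "s \<in> A j" for i j
    proof -
      have "(1/4::real) ^ j \<le> (1/4) ^ Suc i" using that(1) by (intro power_decreasing) auto
      then show False using that(2,3) by (auto simp: A_def)
    qed
    show ?thesis using *[of i j] *[of j i] that by (cases i j rule: linorder_cases) auto
  qed
  have "ennreal ((\<Sum>j\<in>{2..<J}. b j) / 2) = (\<Sum>j\<in>{2..<J}. ennreal (b j / (16 * (1/4) ^ j)) * emeasure lborel (A j))"
  proof -
    have "ennreal (b j / (16 * (1/4) ^ j)) * emeasure lborel (A j) = ennreal (b j / 2)" for j
    proof -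
      have "emeasure lborel (A j) = ennreal (8 * (1/4) ^ j)"
        unfolding A_def by (subst emeasure_lborel_Ioo) auto
      moreover have "b j / (16 * (1/4) ^ j) * (8 * (1/4) ^ j) = b j / 2" by (simp add: field_simps)
      ultimately show ?thesis using b by (simp add: ennreal_mult[symmetric])
    qed
    then show ?thesis using b by (simp add: sum_divide_distrib)
  qed
  also have "\<dots> = (\<Sum>j\<in>{2..<J}. \<integral>\<^sup>+s. ennreal (b j / (16 * (1/4) ^ j)) * indicator (A j) s \<partial>lborel)"
    by (intro sum.cong refl nn_integral_cmult_indicator[symmetric]) (simp add: A_def)
  also have "\<dots> = (\<integral>\<^sup>+s. (\<Sum>j\<in>{2..<J}. ennreal (b j / (16 * (1/4) ^ j)) * indicator (A j) s) \<partial>lborel)"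
    by (intro nn_integral_sum[symmetric] borel_measurable_times_ennreal borel_measurable_indicator)
       (auto simp: A_def)
  also have "\<dots> \<le> (\<integral>\<^sup>+s\<in>{0<..<2}. h s * ennreal (1 / s) \<partial>lborel)"
  proof (rule nn_integral_mono)
    fix s :: real
    show "(\<Sum>j\<in>{2..<J}. ennreal (b j / (16 * (1/4) ^ j)) * indicator (A j) s)
       \<le> h s * ennreal (1 / s) * indicator {0<..<2} s"
    proof (cases "\<exists>i\<in>{2..<J}. s \<in> A i")
      case True
      then obtain i where i: "i \<in> {2..<J}" "s \<in> A i" by blast
      then have ind: "indicator (A j) s = (if j = i then 1 else 0 :: ennreal)" for j
        using disj by (auto simp: indicator_def)
      have si: "8 * (1/4) ^ i < s" "s < 16 * (1/4) ^ i" using i(2) by (auto simp: A_def)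
      have s0: "0 < s" using si(1) by (rule less_trans[rotated]) simp
      have "(1/4::real) ^ i \<le> (1/4)\<^sup>2" using i(1) by (intro power_decreasing) auto
      then have s2: "s < 2" using si(2) by (simp add: power2_eq_square)
      have "(\<Sum>j\<in>{2..<J}. ennreal (b j / (16 * (1/4) ^ j)) * indicator (A j) s) = ennreal (b i / (16 * (1/4) ^ i))"
        using i(1) by (simp add: ind if_distrib[of "(*) _"] cong: if_cong)
      also have "\<dots> \<le> ennreal (b i * (1 / s))"
        using si s0 b[of i] by (intro ennreal_leI) (simp add: frac_le)
      also have "\<dots> = ennreal (b i) * ennreal (1 / s)" using b s0 by (intro ennreal_mult) auto
      also have "\<dots> \<le> h s * ennreal (1 / s)" using h[of i s] i si by (intro mult_right_mono) auto
      finally show ?thesis using s0 s2 by simp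
    next
      case False
      then have "(\<Sum>j\<in>{2..<J}. ennreal (b j / (16 * (1/4) ^ j)) * indicator (A j) s) = 0"
        by (intro sum.neutral) auto
      then show ?thesis by simp
    qed
  qed
  finally show ?thesis .
qed

section \<open>Removal of the exceptional centres, and a covering argument for the others\<close>

lemma finite_mass_bound:
  fixes k :: nat
  assumes k: "1 \<le> k" "k \<le> CARD('n::finite)"
  shows "\<exists>D::real. \<forall>(S :: (real ^ 'n) set) r F.
       (\<forall>x\<in>S. r x > 0 \<and> ball x (r x) \<subseteq> ball 0 2) \<longrightarrow>
       disjoint_family_on (\<lambda>x. ball x (r x)) S \<longrightarrow>
       (emeasure (ball_measure k S r) (ball 0 2) \<ge> ennreal (eps CARD('n) * 2 ^ k) \<longrightarrow>
          (\<integral>\<^sup>+y\<in>ball 0 2.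
             (\<integral>\<^sup>+s\<in>{0<..<2}. displacement k (ball_measure k S r) y s * ennreal (1 / s) \<partial>lborel)
           \<partial>ball_measure k S r) < ennreal (2 ^ k)) \<longrightarrow>
       finite F \<longrightarrow> F \<subseteq> S \<inter> ball 0 1 \<longrightarrow> (\<Sum>x\<in>F. r x ^ k) \<le> D"
proof -
  define \<omega> where "\<omega> = unit_ball_vol (real k)"
  have \<omega>: "0 < \<omega>" unfolding \<omega>_def by (rule unit_ball_vol_pos) simp
  define e where "e = eps CARD('n)"
  have e: "0 \<le> e" by (simp add: e_def eps_def)
  \<comment> \<open>Mass at least \<open>\<Lambda> * t ^ k\<close> has to exceed the threshold of
    the displacement at radius \<open>16 * t\<close>, which gives the second summand; 3 exceeds the
    bound 2 for the sum of the \<open>a i g\<close> below.\<close>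
  define \<Lambda> where "\<Lambda> = 3 + e * 16 ^ k / \<omega>"
  have \<Lambda>: "2 < \<Lambda>" "0 < \<Lambda>" "e * 16 ^ k \<le> \<omega> * \<Lambda>"
    using \<omega> e by (auto simp: \<Lambda>_def distrib_left add_pos_nonneg)
  have "k \<le> card (Basis :: (real ^ 'n) set)" using k by simp
  then obtain K :: "(real ^ 'n) set" where KB: "K \<subseteq> Basis" "card K = k"
    using obtain_subset_with_card_n by metis
  then have "K \<noteq> {}" using k KB by auto
  with KB interpret coord_plane K by unfold_locales
  have "compact (cball (0 :: real ^ 'n) 1)" by simp
  \<comment> \<open>The radius 1/48 is that of \<open>local_mass_bound\<close>.\<close>
  then obtain T where T: "finite T" "cball (0 :: real ^ 'n) 1 \<subseteq> (\<Union>c\<in>T. ball c (1/48))"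
    unfolding compact_eq_totally_bounded by (meson zero_less_divide_1_iff zero_less_numeral)
  define M where "M = 2 * (64 ^ k + \<Lambda> + 16 * 4 ^ k * 2)"
  \<comment> \<open>The bound \<open>2 ^ k\<close> of the hypothesis, divided by a factor
    \<open>\<omega>\<close> from the outer measure, by another from the measure inside the
    displacement together with the normalisation \<open>16 ^ (k + 2)\<close>, and by the 1/2 of
    \<open>dyadic_integral_ge\<close>.\<close>
  define E where "E = 2 ^ k * 2 * 16 ^ (k + 2) / \<omega>\<^sup>2"
  define planes where "planes = {L :: (real ^ 'n) set. affine L \<and> aff_dim L = int k}"
  \<comment> \<open>The infimum of a set of reals below is meaningful only for a nonempty
    set.\<close>
  have planes_ne: "planes \<noteq> {}"
  proof -
    have "independent K" using independent_mono[OF independent_Basis KB(1)] .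
    then have "aff_dim (span K) = int k"
      by (simp add: aff_dim_subspace dim_eq_card_independent KB)
    then have "span K \<in> planes" by (simp add: planes_def subspace_imp_affine)
    then show ?thesis by blast
  qed
  show ?thesis
  proof (intro exI[of _ "e * 2 ^ k / \<omega> + (E + card T * M)"] allI impI)
    fix S :: "(real ^ 'n) set" and r F
    assume balls: "\<forall>x\<in>S. r x > 0 \<and> ball x (r x) \<subseteq> ball 0 2"
      and disj: "disjoint_family_on (\<lambda>x. ball x (r x)) S"
      and hyp: "emeasure (ball_measure k S r) (ball 0 2) \<ge> ennreal (eps CARD('n) * 2 ^ k) \<longrightarrow>
          (\<integral>\<^sup>+y\<in>ball 0 2.
             (\<integral>\<^sup>+s\<in>{0<..<2}. displacement k (ball_measure k S r) y s * ennreal (1 / s) \<partial>lborel)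
           \<partial>ball_measure k S r) < ennreal (2 ^ k)"
      and F: "finite F" "F \<subseteq> S \<inter> ball 0 1"
    let ?\<mu> = "ball_measure k S r"
    have FS: "F \<subseteq> S" using F by blast
    have r: "0 < r x" if "x \<in> F" for x using balls F that by blast
    have rk: "0 \<le> r x ^ k" if "x \<in> F" for x using r[OF that] by simp
    have r4: "r x \<le> 4" if "x \<in> F" for x
    proof -
      have "ball x (r x) \<subseteq> ball 0 2" using balls F that by blast
      then have "norm x + r x \<le> 2"
        using r[OF that] by (auto simp: ball_subset_ball_iff)
      then show ?thesis using norm_ge_zero[of x] by linarith
    qed
    have sep: "r x \<le> dist x y" if "x \<in> F" "y \<in> F" "x \<noteq> y" for x y
    proof (rule ccontr)
      assume "\<not> r x \<le> dist x y"
      then have "y \<in> ball x (r x) \<inter> ball y (r y)" using r[OF that(2)] by simp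
      moreover have "ball x (r x) \<inter> ball y (r y) = {}"
        by (rule disjoint_family_onD[OF disj]) (use FS that in auto)
      ultimately show False by blast
    qed
    have M: "0 \<le> M" using \<Lambda> by (simp add: M_def)
    have E: "0 \<le> E" using \<omega> by (simp add: E_def)
    show "(\<Sum>x\<in>F. r x ^ k) \<le> e * 2 ^ k / \<omega> + (E + card T * M)"
    \<comment> \<open>Below the threshold the integral hypothesis says nothing about the ball of
      radius 2, but then the total mass is small by itself.\<close>
    proof (cases "emeasure ?\<mu> (ball 0 2) < ennreal (e * 2 ^ k)")
      case True
      have "ennreal (\<omega> * (\<Sum>x\<in>F. r x ^ k)) = (\<Sum>x\<in>F. ennreal (\<omega> * r x ^ k))"
        using \<omega> rk by (subst sum_ennreal) (auto simp: sum_distrib_left)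
      also have "\<dots> = (\<Sum>x\<in>F. ennreal (\<omega> * r x ^ k) * indicator (ball 0 2) x)"
        using F by (intro sum.cong) auto
      also have "\<dots> \<le> (\<integral>\<^sup>+y. indicator (ball 0 2) y \<partial>?\<mu>)"
        unfolding \<omega>_def by (rule nn_integral_ball_measure_ge[OF F(1) FS])
      also have "\<dots> = emeasure ?\<mu> (ball 0 2)" by simp
      also note True
      finally have "\<omega> * (\<Sum>x\<in>F. r x ^ k) \<le> e * 2 ^ k"
        using e by (simp add: ennreal_less_iff \<omega> rk sum_nonneg less_imp_le)
      then have "(\<Sum>x\<in>F. r x ^ k) \<le> e * 2 ^ k / \<omega>"
        using \<omega> by (simp add: pos_le_divide_eq mult.commute)
      then show ?thesis using M E by (simp add: add_increasing2)
    next
      case False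
      then have int: "(\<integral>\<^sup>+y\<in>ball 0 2.
             (\<integral>\<^sup>+s\<in>{0<..<2}. displacement k ?\<mu> y s * ennreal (1 / s) \<partial>lborel) \<partial>?\<mu>) < ennreal (2 ^ k)"
        using hyp by (simp add: e_def not_less)
      have "\<exists>J\<ge>2. \<forall>x\<in>F. 64 * (1/4) ^ J < r x"
      proof -
        have ev: "\<forall>\<^sub>F J in sequentially. 64 * (1/4) ^ J < r x" if "x \<in> F" for x
        proof -
          have "(\<lambda>J. 64 * (1/4::real) ^ J) \<longlonglongrightarrow> 64 * 0"
            by (intro tendsto_intros LIMSEQ_realpow_zero) auto
          then show ?thesis using r[OF that] by (intro order_tendstoD(2)) auto
        qed
        have "\<forall>\<^sub>F J in sequentially. 2 \<le> J \<and> (\<forall>x\<in>F. 64 * (1/4) ^ J < r x)"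
          using ev F(1) by (intro eventually_conj eventually_ge_at_top eventually_ball_finite) auto
        then show ?thesis by (auto simp: eventually_at_top_linorder)
      qed
      then obtain J where J: "2 \<le> J" "\<And>x. x \<in> F \<Longrightarrow> 64 * (1/4) ^ J < r x" by blast
      define t :: "nat \<Rightarrow> real" where "t j = (1/4) ^ j" for j
      have t: "0 < t j" for j by (simp add: t_def)
      define mass where "mass j x = (\<Sum>z\<in>{z\<in>F. dist x z < 8 * t j}. r z ^ k)" for j x
      define q where "q j x L = (\<Sum>z\<in>{z\<in>F. dist x z < 8 * t j}. r z ^ k * (infdist z L)\<^sup>2)" for j x L
      \<comment> \<open>The best quadratic approximation of the finite set \<open>F\<close> at
        radius \<open>8 * t j\<close>. The value 0 for light balls mirrors the second branch of the
        displacement, so that \<open>disp\<close> holds in all cases.\<close>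
      define b where "b j x = (if \<Lambda> * t j ^ k \<le> mass j x then Inf (q j x ` planes) / t j ^ (k + 2) else 0)" for j x
      have q0: "0 \<le> q j x L" for j x L
        unfolding q_def using rk by (intro sum_nonneg) auto
      then have bdd: "bdd_below (q j x ` planes)" for j x
        by (intro bdd_belowI[of _ 0]) auto
      have b0: "0 \<le> b j x" for j x
        unfolding b_def using q0 planes_ne t[of j] by (auto intro!: divide_nonneg_nonneg cINF_greatest)
      define c where "c = \<omega> / 16 ^ (k + 2)"
      have c: "0 < c" using \<omega> by (simp add: c_def)
      have disp: "ennreal (c * b j x) \<le> displacement k ?\<mu> x s"
        if "8 * (1/4) ^ j < s" "s < 16 * (1/4) ^ j" for j x s
      proof (cases "\<Lambda> * t j ^ k \<le> mass j x")
        case True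
        have "c * b j x = \<omega> * Inf (q j x ` planes) / (2 * (8 * t j)) ^ (k + 2)"
          using True by (simp add: b_def c_def power_mult_distrib mult.commute)
        also have "ennreal \<dots> \<le> displacement k ?\<mu> x s"
          unfolding \<omega>_def
        proof (rule displacement_ge[OF F(1) FS])
          show "0 \<le> r x" if "x \<in> F" for x using r[OF that] by simp
          show "0 < 8 * t j" using t by simp
          show "8 * t j \<le> s" "s \<le> 2 * (8 * t j)" using that by (auto simp: t_def)
          have "e * 16 ^ k * t j ^ k \<le> \<omega> * \<Lambda> * t j ^ k"
            using \<Lambda> t[of j] by (intro mult_right_mono) auto
          also have "\<dots> \<le> \<omega> * mass j x"
            using True \<omega> by (simp add: mult.assoc)
          finally show "eps CARD('n) * (2 * (8 * t j)) ^ k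
              \<le> unit_ball_vol (real k) * (\<Sum>z\<in>{z \<in> F. dist x z < 8 * t j}. r z ^ k)"
            by (simp add: e_def \<omega>_def mass_def power_mult_distrib)
          show "Inf (q j x ` planes) \<le> (\<Sum>z\<in>{z \<in> F. dist x z < 8 * t j}. r z ^ k * (infdist z L)\<^sup>2)"
            if "affine L" "aff_dim L = int k" for L
            using that bdd unfolding q_def[symmetric] by (intro cInf_lower) (auto simp: planes_def)
        qed
        finally show ?thesis .
      qed (simp add: b_def)
      define B where "B x = (\<Sum>j\<in>{2..<J}. b j x)" for x
      have B0: "0 \<le> B x" for x by (simp add: B_def b0 sum_nonneg)
      have inner: "ennreal (c * B x / 2)
         \<le> (\<integral>\<^sup>+s\<in>{0<..<2}. displacement k ?\<mu> x s * ennreal (1 / s) \<partial>lborel)" for x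
      proof -
        have "ennreal ((\<Sum>j\<in>{2..<J}. c * b j x) / 2)
          \<le> (\<integral>\<^sup>+s\<in>{0<..<2}. displacement k ?\<mu> x s * ennreal (1 / s) \<partial>lborel)"
          using c b0 disp by (intro dyadic_integral_ge) auto
        then show ?thesis by (simp add: B_def sum_distrib_left)
      qed
      have total: "(\<Sum>x\<in>F. r x ^ k * B x) \<le> E"
      proof -
        have "ennreal (\<Sum>x\<in>F. \<omega> * r x ^ k * (c * B x / 2)) = (\<Sum>x\<in>F. ennreal (\<omega> * r x ^ k * (c * B x / 2)))"
          using \<omega> c B0 rk by (subst sum_ennreal) auto
        also have "\<dots> \<le> (\<Sum>x\<in>F. ennreal (\<omega> * r x ^ k) *
            ((\<integral>\<^sup>+s\<in>{0<..<2}. displacement k ?\<mu> x s * ennreal (1 / s) \<partial>lborel) * indicator (ball 0 2) x))"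
        proof (rule sum_mono)
          fix x assume x: "x \<in> F"
          have "ennreal (\<omega> * r x ^ k * (c * B x / 2)) = ennreal (\<omega> * r x ^ k) * ennreal (c * B x / 2)"
            using \<omega> c B0[of x] rk[OF x] by (intro ennreal_mult) auto
          also have "\<dots> \<le> ennreal (\<omega> * r x ^ k) *
            (\<integral>\<^sup>+s\<in>{0<..<2}. displacement k ?\<mu> x s * ennreal (1 / s) \<partial>lborel)"
            by (intro mult_left_mono inner) auto
          finally show "ennreal (\<omega> * r x ^ k * (c * B x / 2)) \<le> ennreal (\<omega> * r x ^ k) *
            ((\<integral>\<^sup>+s\<in>{0<..<2}. displacement k ?\<mu> x s * ennreal (1 / s) \<partial>lborel) * indicator (ball 0 2) x)"
            using x F by auto
        qed
        also have "\<dots> \<le> (\<integral>\<^sup>+y\<in>ball 0 2.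
             (\<integral>\<^sup>+s\<in>{0<..<2}. displacement k ?\<mu> y s * ennreal (1 / s) \<partial>lborel) \<partial>?\<mu>)"
          unfolding \<omega>_def by (rule nn_integral_ball_measure_ge[OF F(1) FS])
        also note int
        finally have "(\<Sum>x\<in>F. \<omega> * r x ^ k * (c * B x / 2)) < 2 ^ k"
          using \<omega> c B0 rk by (subst (asm) ennreal_less_iff) (auto intro!: sum_nonneg)
        moreover have "(\<Sum>x\<in>F. \<omega> * r x ^ k * (c * B x / 2)) = (\<omega> * c / 2) * (\<Sum>x\<in>F. r x ^ k * B x)"
          by (simp add: sum_distrib_left mult_ac)
        ultimately have "(\<omega> * c / 2) * (\<Sum>x\<in>F. r x ^ k * B x) \<le> 2 ^ k" by simp
        then have "(\<Sum>x\<in>F. r x ^ k * B x) \<le> 2 ^ k / (\<omega> * c / 2)"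
          using \<omega> c by (subst pos_le_divide_eq) (auto simp: mult.commute)
        also have "\<dots> = E"
          using \<omega> by (simp add: E_def c_def power2_eq_square)
        finally show ?thesis .
      qed
      \<comment> \<open>Markov's inequality: a centre outside \<open>G\<close> has
        \<open>B x > 1\<close>, so the mass of these centres is at most \<open>E\<close>.\<close>
      define G where "G = {x\<in>F. B x \<le> 1}"
      have GF: "G \<subseteq> F" "finite G" using F(1) by (auto simp: G_def)
      have bad: "(\<Sum>x\<in>F - G. r x ^ k) \<le> E"
      proof -
        have "(\<Sum>x\<in>F - G. r x ^ k) \<le> (\<Sum>x\<in>F - G. r x ^ k * B x)"
        proof (rule sum_mono)
          fix x assume "x \<in> F - G"
          then have "1 \<le> B x" "0 \<le> r x ^ k" using rk by (auto simp: G_def)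
          then show "r x ^ k \<le> r x ^ k * B x" using mult_left_mono[of 1 "B x" "r x ^ k"] by simp
        qed
        also have "\<dots> \<le> (\<Sum>x\<in>F. r x ^ k * B x)"
          using F(1) rk B0 by (intro sum_mono2) auto
        finally show ?thesis using total by simp
      qed
      \<comment> \<open>The slack \<open>1 / J\<close> at each scale replaces the infimum over
        planes by a plane that nearly attains it. Over \<open>J\<close> scales it adds up to 1, so
        the sum of the \<open>a i g\<close> is at most 1 + 1 = 2.\<close>
      have local: "(\<Sum>z\<in>G \<inter> cball x (1/48). r z ^ k) \<le> M" for x
        unfolding M_def KB(2)[symmetric]
      proof (rule local_mass_bound[where J=J and a="\<lambda>j x. (if 2 \<le> j then b j x else 0) + 1 / J"])
        show "r x \<le> dist x y" if "x \<in> G" "y \<in> G" "x \<noteq> y" for x y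
          by (rule sep) (use GF that in auto)
        show "0 \<le> (if 2 \<le> i then b i g else 0) + 1 / real J" for i g using b0 by simp
        show "(\<Sum>i<J. (if 2 \<le> i then b i g else 0) + 1 / real J) \<le> 2" if g: "g \<in> G" for g
        proof -
          have "(\<Sum>i<J. if 2 \<le> i then b i g else 0) = B g"
            unfolding B_def by (rule sum.mono_neutral_cong_right) auto
          moreover have "B g \<le> 1" using g by (simp add: G_def)
          ultimately show ?thesis using J(1) by (simp add: sum.distrib)
        qed
        show "\<exists>L. affine L \<and> aff_dim L = int (card K) \<and>
            (\<Sum>z\<in>{z \<in> G. dist g z < 8 * (1/4) ^ j}. r z ^ card K * (infdist z L)\<^sup>2)
            \<le> ((if 2 \<le> j then b j g else 0) + 1 / real J) * ((1/4) ^ j) ^ (card K + 2)"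
          if g: "g \<in> G" and j: "2 \<le> j" "j < J"
            and dense: "\<Lambda> * ((1/4) ^ j) ^ card K \<le> (\<Sum>z\<in>{z \<in> G. dist g z < 8 * (1/4) ^ j}. r z ^ card K)"
          for g j
        proof -
          \<comment> \<open>The displacement refers to all of \<open>F\<close>, the induction only
            to \<open>G\<close>. Leaving out centres decreases both the mass and the quadratic sum,
            so a ball that is heavy for \<open>G\<close> is heavy for \<open>F\<close>, and a plane
            good for \<open>F\<close> is good for \<open>G\<close>.\<close>
          have "(\<Sum>z\<in>{z \<in> G. dist g z < 8 * (1/4) ^ j}. r z ^ k) \<le> mass j g"
            unfolding mass_def t_def using F(1) GF rk by (intro sum_mono2) auto
          then have bj: "b j g * t j ^ (k + 2) = Inf (q j g ` planes)"
            using dense t[of j] by (simp add: b_def KB t_def)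
          have "Inf (q j g ` planes) < Inf (q j g ` planes) + 1 / J * t j ^ (k + 2)"
            using t[of j] J by simp
          then obtain L where L: "L \<in> planes" "q j g L < Inf (q j g ` planes) + 1 / J * t j ^ (k + 2)"
            using cInf_lessD[of "q j g ` planes"] planes_ne by blast
          have "(\<Sum>z\<in>{z \<in> G. dist g z < 8 * (1/4) ^ j}. r z ^ k * (infdist z L)\<^sup>2) \<le> q j g L"
            unfolding q_def t_def using F(1) GF rk by (intro sum_mono2) auto
          also have "\<dots> \<le> (b j g + 1 / J) * t j ^ (k + 2)"
            unfolding distrib_right bj using L(2) by (rule less_imp_le)
          finally show ?thesis
            using L(1) j by (auto simp: planes_def KB t_def)
        qed
      qed (use GF r r4 \<Lambda> J in auto)
      have "(\<Sum>x\<in>G. r x ^ k) \<le> card T * M"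
      proof -
        have "(\<Sum>x\<in>G. r x ^ k) \<le> (\<Sum>x\<in>G. \<Sum>c\<in>T. if x \<in> cball c (1/48) then r x ^ k else 0)"
        proof (rule sum_mono)
          fix x assume x: "x \<in> G"
          then have "x \<in> cball 0 1" using GF F by auto
          then obtain c where c: "c \<in> T" "x \<in> cball c (1/48)" using T(2) by force
          have "r x ^ k = (if x \<in> cball c (1/48) then r x ^ k else 0)" using c by simp
          also have "\<dots> \<le> (\<Sum>c\<in>T. if x \<in> cball c (1/48) then r x ^ k else 0)"
            by (rule member_le_sum[OF c(1)]) (use T(1) rk x GF in auto)
          finally show "r x ^ k \<le> (\<Sum>c\<in>T. if x \<in> cball c (1/48) then r x ^ k else 0)" .
        qed
        also have "\<dots> = (\<Sum>c\<in>T. \<Sum>x\<in>G. if x \<in> cball c (1/48) then r x ^ k else 0)"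
          by (rule sum.swap)
        also have "\<dots> = (\<Sum>c\<in>T. \<Sum>x\<in>G \<inter> cball c (1/48). r x ^ k)"
          using GF(2) by (simp only: sum.inter_restrict)
        also have "\<dots> \<le> (\<Sum>c\<in>T. M)" by (intro sum_mono local)
        finally show ?thesis by simp
      qed
      moreover have "(\<Sum>x\<in>F. r x ^ k) = (\<Sum>x\<in>F - G. r x ^ k) + (\<Sum>x\<in>G. r x ^ k)"
        using GF F(1) by (simp add: sum.subset_diff)
      moreover have "0 \<le> e * 2 ^ k / \<omega>" using e \<omega> by simp
      ultimately show ?thesis using bad by linarith
    qed
  qed
qed

theorem theorem3p4:
  "\<exists>\<delta>>0. \<exists>D::real. \<forall>k\<in>{1..CARD('n::finite)}.
     \<forall>(S :: (real ^ 'n) set) (r :: real ^ 'n \<Rightarrow> real).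
       (\<forall>x\<in>S. r x > 0 \<and> ball x (r x) \<subseteq> ball 0 2) \<longrightarrow>
       disjoint_family_on (\<lambda>x. ball x (r x)) S \<longrightarrow>
       (\<forall>x t. t > 0 \<longrightarrow> ball x t \<subseteq> ball 0 2 \<longrightarrow>
          emeasure (ball_measure k S r) (ball x t) \<ge> ennreal (eps CARD('n) * t ^ k) \<longrightarrow>
          (\<integral>\<^sup>+y\<in>ball x t.
             (\<integral>\<^sup>+s\<in>{0<..<t}. displacement k (ball_measure k S r) y s * ennreal (1 / s) \<partial>lborel)
           \<partial>ball_measure k S r) < ennreal (\<delta>\<^sup>2 * t ^ k)) \<longrightarrow>
       (\<Sum>\<^sub>\<infinity>x\<in>S \<inter> ball 0 1. ennreal (r x ^ k)) < ennreal D"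
proof -
  have "\<forall>k\<in>{1..CARD('n)}. \<exists>D::real. \<forall>(S :: (real ^ 'n) set) r F.
       (\<forall>x\<in>S. r x > 0 \<and> ball x (r x) \<subseteq> ball 0 2) \<longrightarrow>
       disjoint_family_on (\<lambda>x. ball x (r x)) S \<longrightarrow>
       (emeasure (ball_measure k S r) (ball 0 2) \<ge> ennreal (eps CARD('n) * 2 ^ k) \<longrightarrow>
          (\<integral>\<^sup>+y\<in>ball 0 2.
             (\<integral>\<^sup>+s\<in>{0<..<2}. displacement k (ball_measure k S r) y s * ennreal (1 / s) \<partial>lborel)
           \<partial>ball_measure k S r) < ennreal (2 ^ k)) \<longrightarrow>
       finite F \<longrightarrow> F \<subseteq> S \<inter> ball 0 1 \<longrightarrow> (\<Sum>x\<in>F. r x ^ k) \<le> D"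
    (is "\<forall>k\<in>_. \<exists>D. ?P k D")
  proof (rule ballI)
    show "\<exists>D. ?P k D" if "k \<in> {1..CARD('n)}" for k
      by (rule finite_mass_bound) (use that in simp_all)
  qed
  from bchoice[OF this] obtain D where D: "\<forall>k\<in>{1..CARD('n)}. ?P k (D k)" by blast
  \<comment> \<open>Summing over the finitely many \<open>k\<close> gives one constant that depends
    on the dimension alone.\<close>
  define D' where "D' = (\<Sum>k\<in>{1..CARD('n)}. \<bar>D k\<bar>)"
  show ?thesis
  \<comment> \<open>With delta = 1 the hypothesis is applied to the ball of radius 2 about the
    origin; \<open>D' + 1\<close> makes the final inequality strict.\<close>
  proof (rule exI[of _ 1], rule conjI[OF zero_less_one], rule exI[of _ "D' + 1"], intro ballI allI impI)
    fix k and S :: "(real ^ 'n) set" and r :: "real ^ 'n \<Rightarrow> real"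
    assume k: "k \<in> {1..CARD('n)}"
      and balls: "\<forall>x\<in>S. r x > 0 \<and> ball x (r x) \<subseteq> ball 0 2"
      and disj: "disjoint_family_on (\<lambda>x. ball x (r x)) S"
      and hyp: "\<forall>x t. t > 0 \<longrightarrow> ball x t \<subseteq> ball 0 2 \<longrightarrow>
          emeasure (ball_measure k S r) (ball x t) \<ge> ennreal (eps CARD('n) * t ^ k) \<longrightarrow>
          (\<integral>\<^sup>+y\<in>ball x t.
             (\<integral>\<^sup>+s\<in>{0<..<t}. displacement k (ball_measure k S r) y s * ennreal (1 / s) \<partial>lborel)
           \<partial>ball_measure k S r) < ennreal (1\<^sup>2 * t ^ k)"
    have "\<bar>D k\<bar> \<le> D'"
      unfolding D'_def using k by (intro member_le_sum) auto
    then have DD: "D k \<le> D'" "0 \<le> D'" by auto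
    have bound: "(\<Sum>x\<in>F. ennreal (r x ^ k)) \<le> ennreal D'" if F: "finite F" "F \<subseteq> S \<inter> ball 0 1" for F
    proof -
      have "0 \<le> r x ^ k" if "x \<in> F" for x
      proof -
        have "0 < r x" using balls F(2) that by blast
        then show ?thesis by simp
      qed
      then have "(\<Sum>x\<in>F. ennreal (r x ^ k)) = ennreal (\<Sum>x\<in>F. r x ^ k)"
        by (rule sum_ennreal)
      also have "(\<Sum>x\<in>F. r x ^ k) \<le> D k"
        by (rule D[THEN bspec, OF k, THEN spec, THEN spec, THEN spec, THEN mp, OF balls,
              THEN mp, OF disj, THEN mp, THEN mp, OF _ F(1), THEN mp, OF _ F(2)])
           (use hyp[rule_format, of 2 0] in simp)
      finally show ?thesis using DD(1) by (meson ennreal_leI order_trans)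
    qed
    \<comment> \<open>The infinite sum is the supremum of the finite ones, for which the bound does
      not depend on the number of scales.\<close>
    have "(\<Sum>\<^sub>\<infinity>x\<in>S \<inter> ball 0 1. ennreal (r x ^ k))
        = (SUP F\<in>{F. finite F \<and> F \<subseteq> S \<inter> ball 0 1}. \<Sum>x\<in>F. ennreal (r x ^ k))"
      by (rule nonneg_infsum_complete) simp
    also have "\<dots> \<le> ennreal D'"
      by (rule SUP_least) (use bound in blast)
    also have "\<dots> < ennreal (D' + 1)" using DD(2) by (simp add: ennreal_less_iff)
    finally show "(\<Sum>\<^sub>\<infinity>x\<in>S \<inter> ball 0 1. ennreal (r x ^ k)) < ennreal (D' + 1)" .
  qed
qed

end
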